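(* Let $n>1$ and $1<p\le q<\infty$ be such that $\Theta(1):=1+n\left(\frac1q-\frac1p\right)>0$ and $p'\,\Theta(1)<n$, where $\frac1p+\frac1{p'}=1$. Let $u\in A_1(\mathbb{R}^n)$. Then there exists $C>0$, depending only on $n,p,q$ and $[u]_{A_1}$, such that $$\left(\int_{\mathbb{R}^n}|f(x)|^q u(x)\,dx\right)^{1/q}\le C\left(\int_{\mathbb{R}^n}|\nabla f(x)|^p\,|x|^{\Theta(1)p}\,u(x)^{p/q}\,dx\right)^{1/p}\quad\text{for every }f\in C_0^1(\mathbb{R}^n).$$
   Context: $Q$ denotes a cube in $\mathbb{R}^n$ with sides parallel to the coordinate axes. $C_0^1(\mathbb{R}^n)$ is the set of continuously differentiable functions on $\mathbb{R}^n$ vanishing at infinity. A weight is a function $w\in L^1_{\rm loc}(\mathbb{R}^n)$ with $w\ge0$ a.e.; $w\in A_1(\mathbb{R}^n)$ means $[w]_{A_1}:=\sup_Q\left(\frac1{|Q|}\int_Q w\right)\left(\operatorname{ess\,inf}_Q w\right)^{-1}<\infty$ (supremum over all such cubes), where, as usual, $w$ is not a.e. zero (so $w>0$ a.e.). *)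

theory Defs
  imports "HOL-Analysis.Analysis"
begin

definition cubes :: "(real^'n) set set" where
  "cubes = {cbox a (\<chi> i. a $ i + l) | a l. l > 0}"

definition weight :: "(real^'n \<Rightarrow> real) \<Rightarrow> bool" where
  "weight w \<longleftrightarrow>
     (\<forall>K. compact K \<longrightarrow> w absolutely_integrable_on K) \<and> (AE x in lebesgue. 0 \<le> w x)"

text \<open>
  The essential infimum is the limit inferior along the almost-everywhere filter, dual to
  \<open>esssup\<close> in HOL-Probability. Values are taken in \<^typ>\<open>ennreal\<close>, which is harmless for
  functions that are nonnegative almost everywhere.
\<close>

definition ess_inf_on :: "(real^'n) set \<Rightarrow> (real^'n \<Rightarrow> real) \<Rightarrow> ennreal" where
  "ess_inf_on Q w = Liminf (ae_filter (lebesgue_on Q)) (\<lambda>x. ennreal (w x))"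

definition average_on :: "(real^'n) set \<Rightarrow> (real^'n \<Rightarrow> real) \<Rightarrow> ennreal" where
  "average_on Q w = (\<integral>\<^sup>+x\<in>Q. ennreal (w x) \<partial>lebesgue) / emeasure lebesgue Q"

text \<open>
  In \<^typ>\<open>ennreal\<close> we have \<open>inverse 0 = \<infinity>\<close> and \<open>0 * \<infinity> = 0\<close>. A cube on which \<open>w\<close> vanishes
  almost everywhere thus contributes \<open>0\<close>; but if \<open>w\<close> is not almost everywhere zero, some larger
  cube then contributes \<open>\<infinity>\<close>.
\<close>

definition A1_const :: "(real^'n \<Rightarrow> real) \<Rightarrow> ennreal" where
  "A1_const w = (SUP Q\<in>cubes. average_on Q w * inverse (ess_inf_on Q w))"

definition A1_weights :: "(real^'n \<Rightarrow> real) set" where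
  "A1_weights = {w. weight w \<and> \<not> (AE x in lebesgue. w x = 0) \<and> A1_const w < \<infinity>}"

definition gradient :: "(real^'n \<Rightarrow> real) \<Rightarrow> real^'n \<Rightarrow> real^'n" where
  "gradient f x = (THE D. GDERIV f x :> D)"

lemma gradient_eqI:
  assumes "GDERIV f x :> D"
  shows "gradient f x = D"
  unfolding gradient_def
proof (rule the_equality, rule assms)
  fix E assume "GDERIV f x :> E"
  then have "(\<lambda>h. inner h E) = (\<lambda>h. inner h D)"
    using assms has_derivative_unique unfolding gderiv_def by blast
  then show "E = D"
    by (metis vector_eq_ldot vector_eq_rdot)
qed

lemma GDERIV_gradient:
  fixes f :: "real^'n \<Rightarrow> real"
  assumes "f differentiable (at x)"
  shows "GDERIV f x :> gradient f x"
proof -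
  obtain f' where f': "(f has_derivative f') (at x)"
    using assms unfolding differentiable_def by blast
  then have "linear f'"
    by (rule has_derivative_linear)
  then have "f' = (\<lambda>h. inner h (adjoint f' 1))"
    by (auto simp: adjoint_works)
  with f' have "GDERIV f x :> adjoint f' 1"
    unfolding gderiv_def by metis
  then show ?thesis
    using gradient_eqI by metis
qed

text \<open>Continuously differentiable functions vanishing at infinity; no decay of the gradient is
  required.\<close>

definition C1_0 :: "(real^'n \<Rightarrow> real) set" where
  "C1_0 = {f. (\<forall>x. f differentiable (at x)) \<and> continuous_on UNIV (gradient f)
              \<and> (f \<longlongrightarrow> 0) at_infinity}"

text \<open>Powers of possibly infinite integrals; meaningful for exponents \<open>a > 0\<close> only.\<close>

definition ennreal_powr :: "ennreal \<Rightarrow> real \<Rightarrow> ennreal" where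
  "ennreal_powr x a = (if x = \<infinity> then \<infinity> else ennreal (enn2real x powr a))"

end

theory Submission
  imports Defs
begin

text \<open>
  The case \<open>p = 1\<close> carries the whole argument. Averaging the fundamental theorem of calculus over
  rays that leave \<open>x\<close> in directions \<open>v\<close> with \<open>v \<bullet> x \<ge> 0\<close> gives
  \<open>\<bar>F x\<bar> \<le> K \<integral>\<^bsub>\<bar>y\<bar> \<ge> \<bar>x\<bar>\<^esub> \<bar>\<nabla>F y\<bar> \<bar>x - y\<bar>\<^bsup>1-n\<^esup> dy\<close>. The restriction \<open>\<bar>x\<bar> \<le> \<bar>y\<bar>\<close> confines \<open>x\<close>
  to the ball of radius \<open>2\<bar>y\<bar>\<close> around \<open>y\<close>, and there the \<open>A\<^sub>1\<close> condition bounds the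
  \<open>L\<^bsup>r\<^esup>(u)\<close> norm of the kernel by a multiple of \<open>\<bar>y\<bar>\<^bsup>\<Theta>\<^esup> u(y)\<^bsup>1/r\<^esup>\<close>, where
  \<open>1/r = 1/q + 1/p'\<close>, that is, \<open>n/r = n - 1 + \<Theta>\<close>. Minkowski's inequality then yields
  \<open>\<parallel>F\<parallel>\<^bsub>L\<^sup>r(u)\<^esub> \<le> C \<integral> \<bar>\<nabla>F\<bar> \<bar>y\<bar>\<^bsup>\<Theta>\<^esup> u\<^bsup>1/r\<^esup>\<close>. For \<open>p > 1\<close> this is applied to
  \<open>F = (\<bar>f\<bar> - \<epsilon>)\<^sub>+\<^bsup>\<gamma>\<^esup>\<close> with \<open>\<gamma> = 1 + q/p' = q/r\<close>; after Hoelder's inequality the power of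
  \<open>\<integral> (\<bar>f\<bar> - \<epsilon>)\<^sub>+\<^bsup>q\<^esup> u\<close> on the right is absorbed, which is legitimate because the truncation
  makes this integral finite. Finally \<open>\<epsilon> \<rightarrow> 0\<close>.
\<close>

section \<open>Jensen's inequality for powers\<close>

text \<open>
  Weighted by \<open>m\<close>, this serves both as Minkowski's and as Hoelder's inequality. The proof is Young's
  inequality with parameter \<open>t = F / I\<close>.
\<close>

lemma nn_integral_Jensen_powr:
  fixes h m :: "'a \<Rightarrow> real" and F I r :: real
  assumes [measurable]: "h \<in> borel_measurable M" "m \<in> borel_measurable M"
    and nn: "\<And>x. 0 \<le> h x" "\<And>x. 0 \<le> m x" and r: "1 \<le> r" and F: "0 \<le> F" and I: "0 \<le> I"
    and le: "ennreal F \<le> (\<integral>\<^sup>+x. ennreal (h x * m x) \<partial>M)"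
    and mI: "(\<integral>\<^sup>+x. ennreal (m x) \<partial>M) \<le> ennreal I"
  shows "ennreal (F powr r) \<le> ennreal (I powr (r - 1)) * (\<integral>\<^sup>+x. ennreal (h x powr r * m x) \<partial>M)"
proof (cases "F = 0")
  case True then show ?thesis by simp
next
  case False
  with F have F: "F > 0" by simp
  \<comment> \<open>The parameter \<open>t = F / I\<close> needs \<open>I > 0\<close>: if
    \<open>I = 0\<close>, then \<open>m\<close> vanishes almost everywhere, and with it the integral
    that dominates \<open>F\<close>.\<close>
  have "I \<noteq> 0"
  proof
    assume "I = 0"
    with mI have "(\<integral>\<^sup>+x. ennreal (m x) \<partial>M) = 0" by simp
    then have "AE x in M. m x \<le> 0"
      by (subst (asm) nn_integral_0_iff_AE) (auto simp: ennreal_eq_0_iff)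
    then have "AE x in M. ennreal (h x * m x) = 0"
      by eventually_elim (use nn in \<open>auto simp: ennreal_eq_0_iff mult_nonneg_nonpos\<close>)
    then have "(\<integral>\<^sup>+x. ennreal (h x * m x) \<partial>M) = 0"
      by (subst nn_integral_0_iff_AE) auto
    with le F show False by simp
  qed
  with I have I: "I > 0" by simp
  define t where "t = F / I"
  have t: "t > 0" using F I by (simp add: t_def)
  let ?S = "\<integral>\<^sup>+x. ennreal (h x powr r * m x) \<partial>M"
  \<comment> \<open>Young's inequality with weights \<open>1/r\<close> and \<open>1 - 1/r\<close>,
    applied to \<open>h x powr r * t powr (1-r)\<close> and \<open>t\<close>: in the product the
    powers of \<open>t\<close> cancel and \<open>h x\<close> remains.\<close>
  have Y: "h x \<le> t powr (1 - r) / r * h x powr r + (1 - 1/r) * t" for x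
  proof -
    have "(h x powr r * t powr (1-r)) powr (1/r) * t powr (1 - 1/r) \<le> 1/r * (h x powr r * t powr (1-r)) + (1 - 1/r) * t"
    proof (cases "h x = 0")
      case True
      then show ?thesis using r t by simp
    next
      case False
      then show ?thesis
        by (intro Youngs_inequality_0) (use r t in auto)
    qed
    moreover have "(h x powr r * t powr (1-r)) powr (1/r) * t powr (1 - 1/r) = h x"
    proof -
      have "(1 - r) / r + (1 - 1/r) = 0" using r by (simp add: field_simps)
      then have "t powr ((1 - r) / r) * t powr (1 - 1/r) = 1"
        using t by (metis powr_add powr_zero_eq_one order_less_irrefl)
      then show ?thesis
        using r nn(1)[of x] t by (simp add: powr_mult powr_powr)
    qed
    ultimately show ?thesis by (simp add: field_simps)
  qed
  have "ennreal F \<le> (\<integral>\<^sup>+x. ennreal (t powr (1 - r) / r) * ennreal (h x powr r * m x) + ennreal ((1 - 1/r) * t) * ennreal (m x) \<partial>M)"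
  proof (rule order.trans[OF le], rule nn_integral_mono)
    fix x
    have A: "0 \<le> t powr (1 - r) / r" and B: "0 \<le> (1 - 1/r) * t"
      using r t by auto
    have "h x * m x \<le> (t powr (1 - r) / r * h x powr r + (1 - 1/r) * t) * m x"
      by (rule mult_right_mono) (use Y nn in auto)
    also have "\<dots> = t powr (1 - r) / r * (h x powr r * m x) + (1 - 1/r) * t * m x"
      by (simp only: distrib_right mult.assoc)
    also have "ennreal \<dots> = ennreal (t powr (1 - r) / r) * ennreal (h x powr r * m x) + ennreal ((1 - 1/r) * t) * ennreal (m x)"
      using A B nn(2)[of x] by (simp only: ennreal_mult ennreal_plus mult_nonneg_nonneg powr_ge_zero)
    finally show "ennreal (h x * m x) \<le> ennreal (t powr (1 - r) / r) * ennreal (h x powr r * m x) + ennreal ((1 - 1/r) * t) * ennreal (m x)"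
      by (simp add: ennreal_leI)
  qed
  also have "\<dots> = ennreal (t powr (1 - r) / r) * ?S + ennreal ((1 - 1/r) * t) * (\<integral>\<^sup>+x. ennreal (m x) \<partial>M)"
    by (simp add: nn_integral_add nn_integral_cmult)
  also have "\<dots> \<le> ennreal (t powr (1 - r) / r) * ?S + ennreal ((1 - 1/r) * t) * ennreal I"
    by (intro add_left_mono mult_left_mono mI) auto
  also have "ennreal ((1 - 1/r) * t) * ennreal I = ennreal ((1 - 1/r) * F)"
  proof -
    have "0 \<le> (1 - 1/r) * t" using t r by auto
    moreover have "(1 - 1/r) * t * I = (1 - 1/r) * F" using I by (simp add: t_def)
    ultimately show ?thesis using I by (metis ennreal_mult less_imp_le)
  qed
  finally have main: "ennreal F \<le> ennreal (t powr (1 - r) / r) * ?S + ennreal ((1 - 1/r) * F)" .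
  show ?thesis
  proof (cases ?S)
    case top
    then show ?thesis using I by (simp add: ennreal_mult_top)
  next
    case (real s)
    with main have "ennreal F \<le> ennreal (t powr (1 - r) / r * s + (1 - 1/r) * F)"
      using r F t by (simp add: ennreal_mult[symmetric] ennreal_plus[symmetric] del: ennreal_plus)
    then have "F \<le> t powr (1 - r) / r * s + (1 - 1/r) * F"
      using r F real by (subst (asm) ennreal_le_iff) auto
    then have "F \<le> t powr (1-r) * s" using r by (simp add: field_simps)
    then have "F * t powr (r-1) \<le> t powr (1-r) * s * t powr (r-1)" by (rule mult_right_mono) simp
    also have "\<dots> = s" using t by (simp add: powr_add[symmetric] mult.commute mult.left_commute)
    finally have "F * t powr (r-1) \<le> s" .
    moreover have "F * t powr (r-1) * I powr (r-1) = F powr r"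
      using F I by (simp add: t_def powr_divide powr_mult_base)
    ultimately have "F powr r \<le> I powr (r-1) * s"
      by (metis mult.commute mult_right_mono powr_ge_zero)
    then show ?thesis using real by (simp add: ennreal_mult[symmetric] ennreal_leI)
  qed
qed

section \<open>Pointwise consequences of the \<open>A\<^sub>1\<close> condition\<close>

text \<open>\<open>Liminf\<close> only yields \<open>c < w x\<close> almost everywhere for each
  fixed \<open>c\<close> strictly below the essential infimum. Countably many such \<open>c\<close>
  converging to it share one null set, and the limit gives the claim.\<close>

lemma AE_ess_inf_on_le: "AE x in lebesgue_on Q. ess_inf_on Q w \<le> ennreal (w x)"
proof (cases "ess_inf_on Q w = 0")
  case False
  then have "0 < ess_inf_on Q w" by (simp add: zero_less_iff_neq_zero)
  then obtain c :: "nat \<Rightarrow> ennreal" where c: "\<And>n. c n < ess_inf_on Q w" "c \<longlonglongrightarrow> ess_inf_on Q w"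
    using approx_from_below_dense_linorder by blast
  have "AE x in lebesgue_on Q. c n < ennreal (w x)" for n
    using less_LiminfD[OF c(1)[of n, unfolded ess_inf_on_def]] .
  then have "AE x in lebesgue_on Q. \<forall>n. c n < ennreal (w x)"
    by (subst AE_all_countable) blast
  then show ?thesis
  proof eventually_elim
    case (elim x)
    then show ?case by (intro LIMSEQ_le_const2[OF c(2)]) (auto intro: less_imp_le)
  qed
qed simp

text \<open>Local integrability gives measurability of the cutoffs of \<open>w\<close> to balls, and
  at each point these cutoffs are eventually equal to \<open>w\<close>.\<close>

lemma weight_borel_measurable:
  assumes "weight w" shows "w \<in> borel_measurable lebesgue"
proof (rule borel_measurable_LIMSEQ_real)
  fix x :: "real^'a"
  obtain N :: nat where N: "norm x \<le> real N" using real_arch_simple by blast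
  have "\<forall>\<^sub>F i in sequentially. indicator (cball 0 (real i)) x *\<^sub>R w x = w x"
    using eventually_ge_at_top[of N] by eventually_elim (use N in \<open>auto simp: indicator_def\<close>)
  then show "(\<lambda>i. indicator (cball 0 (real i)) x *\<^sub>R w x) \<longlonglongrightarrow> w x"
    by (rule tendsto_eventually)
next
  fix i :: nat
  show "(\<lambda>x. indicator (cball 0 (real i)) x *\<^sub>R w x) \<in> borel_measurable lebesgue"
    using assms unfolding weight_def set_integrable_def by (auto intro: borel_measurable_integrable)
qed

text \<open>The quotient in \<open>A1_const\<close> is multiplied out: the average over
  \<open>Q\<close> is at most the constant times the essential infimum, which lies below
  \<open>u y\<close> for almost every \<open>y\<close> in \<open>Q\<close>. The null set still
  depends on the cube.\<close>

lemma A1_cube_bound: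
  fixes u :: "real^'n \<Rightarrow> real"
    and a :: "real^'n"
  assumes u: "u \<in> A1_weights" and l: "l > 0"
  defines "Q \<equiv> cbox a (\<chi> i. a $ i + l)"
  shows "AE y in lebesgue. y \<in> Q \<longrightarrow>
    (\<integral>\<^sup>+x\<in>Q. ennreal (u x) \<partial>lebesgue) \<le> ennreal (enn2real (A1_const u) * l ^ CARD('n) * u y)"
proof -
  let ?A = "A1_const u" and ?L = "ess_inf_on Q u" and ?I = "\<integral>\<^sup>+x\<in>Q. ennreal (u x) \<partial>lebesgue"
  have A: "?A < \<infinity>" and w: "weight u" using u by (auto simp: A1_weights_def)
  have Q: "Q \<in> cubes" using l unfolding cubes_def Q_def by blast
  have vol: "emeasure lebesgue Q = ennreal (l ^ CARD('n))"
  proof -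
    have "(\<Prod>b\<in>Basis. ((\<chi> i. a $ i + l) - a) \<bullet> b) = (\<Prod>b\<in>(Basis::(real^'n) set). l)"
      by (rule prod.cong) (auto simp: Basis_vec_def inner_axis)
    moreover have "a \<bullet> b \<le> (\<chi> i. a $ i + l) \<bullet> b" if "b \<in> Basis" for b
      using that l by (auto simp: Basis_vec_def inner_axis)
    ultimately show ?thesis
      unfolding Q_def by (simp add: emeasure_lborel_cbox_eq)
  qed
  have "average_on Q u * inverse ?L \<le> ?A"
    unfolding A1_const_def by (rule SUP_upper) (rule Q)
  then have le: "?I / ennreal (l ^ CARD('n)) * inverse ?L \<le> ?A"
    by (simp add: average_on_def vol)
  have "AE y in lebesgue. y \<in> Q \<longrightarrow> ?L \<le> ennreal (u y)"
    using AE_ess_inf_on_le[of Q u] unfolding Q_def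
    by (subst (asm) AE_restrict_space_iff) auto
  moreover have "AE y in lebesgue. 0 \<le> u y" using w by (simp add: weight_def)
  ultimately show ?thesis
  proof eventually_elim
    fix y assume y: "y \<in> Q \<longrightarrow> ?L \<le> ennreal (u y)" "0 \<le> u y"
    show "y \<in> Q \<longrightarrow> ?I \<le> ennreal (enn2real ?A * l ^ CARD('n) * u y)"
    proof
      assume "y \<in> Q"
      with y have L: "?L \<le> ennreal (u y)" by simp
      then have Lfin: "?L < \<infinity>" by (rule order.strict_trans1) simp
      have "?I / ennreal (l ^ CARD('n)) \<le> ?A * ?L"
      \<comment> \<open>Here the conventions of \<open>ennreal\<close> matter:
        \<open>inverse 0\<close> is infinite, so a finite \<open>A1_const u\<close> forces the
        average to vanish when the essential infimum does.\<close>
      proof (cases "?L = 0")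
        case True
        with le A have "?I / ennreal (l ^ CARD('n)) = 0"
          by (auto simp: ennreal_mult_top split: if_splits)
        then show ?thesis by simp
      next
        case False
        have "?I / ennreal (l ^ CARD('n)) = ?I / ennreal (l ^ CARD('n)) * (inverse ?L * ?L)"
          using ennreal_mult_divide_eq[of ?L 1] False Lfin by (simp add: divide_ennreal_def mult.commute[of "inverse ?L"])
        also have "\<dots> \<le> ?A * ?L"
          unfolding mult.assoc[symmetric] by (rule mult_right_mono[OF le]) simp
        finally show ?thesis .
      qed
      also have "\<dots> \<le> ?A * ennreal (u y)" by (rule mult_left_mono[OF L]) simp
      finally have "?I / ennreal (l ^ CARD('n)) * ennreal (l ^ CARD('n)) \<le> ?A * ennreal (u y) * ennreal (l ^ CARD('n))"
        by (rule mult_right_mono) simp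
      moreover have "?I / ennreal (l ^ CARD('n)) * ennreal (l ^ CARD('n)) = ?I"
        using l by (simp add: ennreal_divide_times ennreal_times_divide ennreal_mult_divide_eq)
      moreover have "?A * ennreal (u y) * ennreal (l ^ CARD('n)) = ennreal (enn2real ?A * l ^ CARD('n) * u y)"
      proof -
        obtain r where r: "0 \<le> r" "?A = ennreal r" using A by (cases ?A) auto
        then show ?thesis using l y(2) by (simp add: ennreal_mult[symmetric] mult_ac)
      qed
      ultimately show "?I \<le> ennreal (enn2real ?A * l ^ CARD('n) * u y)" by simp
    qed
  qed
qed

text \<open>
  Cubes with corners in a countable dense set and rational side length suffice to make the
  exceptional null set independent of the radius.
\<close>

lemma A1_ball_bound:
  fixes u :: "real^'n \<Rightarrow> real"
  assumes u: "u \<in> A1_weights"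
  shows "AE y in lebesgue. \<forall>R>0.
    (\<integral>\<^sup>+x\<in>cball y R. ennreal (u x) \<partial>lebesgue) \<le> ennreal (enn2real (A1_const u) * (4 * R) ^ CARD('n) * u y)"
proof -
  obtain D :: "(real^'n) set" where D: "countable D" "\<And>X. open X \<Longrightarrow> X \<noteq> {} \<Longrightarrow> \<exists>d\<in>D. d \<in> X"
    using countable_dense_exists by blast
  define Q where "Q a l = cbox a (\<chi> i. a $ i + l)" for a :: "real^'n" and l
  let ?A = "enn2real (A1_const u)"
  have "AE y in lebesgue. \<forall>z\<in>D \<times> {l\<in>\<rat>. l > 0}. y \<in> Q (fst z) (snd z) \<longrightarrow>
    (\<integral>\<^sup>+x\<in>Q (fst z) (snd z). ennreal (u x) \<partial>lebesgue) \<le> ennreal (?A * snd z ^ CARD('n) * u y)"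
    by (subst AE_ball_countable)
      (use D(1) countable_rat in \<open>auto intro!: A1_cube_bound[OF u] countable_SIGMA simp: Q_def intro: countable_subset[of _ "\<rat>"]\<close>)
  moreover have "AE y in lebesgue. 0 \<le> u y" using u by (simp add: weight_def A1_weights_def)
  ultimately show ?thesis
  proof (eventually_elim, intro allI impI)
    fix y and R :: real
    assume Q: "\<forall>z\<in>D \<times> {l\<in>\<rat>. l > 0}. y \<in> Q (fst z) (snd z) \<longrightarrow>
      (\<integral>\<^sup>+x\<in>Q (fst z) (snd z). ennreal (u x) \<partial>lebesgue) \<le> ennreal (?A * snd z ^ CARD('n) * u y)"
      and uy: "0 \<le> u y" and R: "R > 0"
    \<comment> \<open>The corner \<open>a\<close> lies between \<open>R\<close> and
      \<open>2 * R\<close> below \<open>y\<close> in each coordinate, so a side longer than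
      \<open>3 * R\<close> reaches past \<open>y $ i + R\<close>. Keeping the side below
      \<open>4 * R\<close> produces the factor \<open>4\<close> in the claim.\<close>
    have "box (\<chi> i. y $ i - 2 * R) (\<chi> i. y $ i - R) \<noteq> {}"
      using R by (simp add: box_ne_empty Basis_vec_def inner_axis)
    then obtain a where a: "a \<in> D" "\<And>i. y $ i - 2 * R < a $ i" "\<And>i. a $ i < y $ i - R"
      using D(2)[of "box (\<chi> i. y $ i - 2 * R) (\<chi> i. y $ i - R)"] by (auto simp: mem_box_cart)
    obtain l where l: "l \<in> \<rat>" "3 * R < l" "l < 4 * R"
      using Rats_dense_in_real[of "3*R" "4*R"] R by auto
    have sub: "cball y R \<subseteq> Q a l"
    proof
      fix x assume "x \<in> cball y R"
      then have "\<bar>y $ i - x $ i\<bar> \<le> R" for i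
        using component_le_norm_cart[of "y - x" i] by (simp add: dist_norm)
      then have "a $ i \<le> x $ i \<and> x $ i \<le> a $ i + l" for i
        using a(2,3)[of i] l by (smt (verit))
      then show "x \<in> Q a l" by (simp add: Q_def mem_box_cart)
    qed
    have "y \<in> Q a l" using sub R by auto
    have "(\<integral>\<^sup>+x\<in>cball y R. ennreal (u x) \<partial>lebesgue) \<le> (\<integral>\<^sup>+x\<in>Q a l. ennreal (u x) \<partial>lebesgue)"
      using sub by (intro nn_integral_mono) (auto simp: indicator_def)
    also have "\<dots> \<le> ennreal (?A * l ^ CARD('n) * u y)"
      using Q[rule_format, of "(a, l)"] \<open>y \<in> Q a l\<close> a l R by simp
    also have "\<dots> \<le> ennreal (?A * (4 * R) ^ CARD('n) * u y)"
      using l R uy by (intro ennreal_leI mult_right_mono mult_left_mono power_mono) auto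
    finally show "(\<integral>\<^sup>+x\<in>cball y R. ennreal (u x) \<partial>lebesgue) \<le> ennreal (?A * (4 * R) ^ CARD('n) * u y)" .
  qed
qed

text \<open>If \<open>u y = 0\<close> at a single point where the ball bound holds for all radii,
  then \<open>u\<close> has integral zero over every ball around \<open>y\<close>, hence vanishes
  almost everywhere, which membership in \<open>A1_weights\<close> excludes.\<close>

lemma A1_weight_pos:
  assumes u: "u \<in> A1_weights" shows "AE y in lebesgue. 0 < u y"
proof -
  have w: "weight u" and nz: "\<not> (AE x in lebesgue. u x = 0)" using u by (auto simp: A1_weights_def)
  have [measurable]: "u \<in> borel_measurable lebesgue" by (rule weight_borel_measurable[OF w])
  have nn: "AE y in lebesgue. 0 \<le> u y" using w by (simp add: weight_def)
  with A1_ball_bound[OF u] show ?thesis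
  proof eventually_elim
    fix y assume *: "\<forall>R>0. (\<integral>\<^sup>+x\<in>cball y R. ennreal (u x) \<partial>lebesgue)
      \<le> ennreal (enn2real (A1_const u) * (4 * R) ^ CARD('a) * u y)" and "0 \<le> u y"
    show "0 < u y"
    proof (rule ccontr)
      assume "\<not> 0 < u y"
      with \<open>0 \<le> u y\<close> have "u y = 0" by simp
      have [measurable]: "cball y s \<in> sets lebesgue" for s by simp
      have "AE x in lebesgue. ennreal (u x) * indicator (cball y (real (Suc n))) x = 0" for n
        by (subst nn_integral_0_iff_AE[symmetric]) (use *[rule_format, of "real (Suc n)"] \<open>u y = 0\<close> in auto)
      then have "AE x in lebesgue. \<forall>n. ennreal (u x) * indicator (cball y (real (Suc n))) x = 0"
        by (subst AE_all_countable) blast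
      with nn have "AE x in lebesgue. u x = 0"
      proof eventually_elim
        fix x assume "\<forall>n. ennreal (u x) * indicator (cball y (real (Suc n))) x = 0" "0 \<le> u x"
        moreover obtain n :: nat where "dist y x \<le> real n" using real_arch_simple by blast
        then have "x \<in> cball y (real (Suc n))" by simp
        ultimately have "ennreal (u x) = 0" by (metis indicator_simps(1) mult.right_neutral)
        with \<open>0 \<le> u x\<close> show "u x = 0" by (simp add: ennreal_eq_0_iff)
      qed
      with nz show False by simp
    qed
  qed
qed

text \<open>Passing to a Borel representative makes Fubini on \<open>lborel\<close> applicable.
  Resetting the nonpositive values to \<open>1\<close> changes only a null set and allows negative
  powers of the weight at every point.\<close>

lemma A1_borel_version:
  fixes u :: "real^'n \<Rightarrow> real"
  assumes u: "u \<in> A1_weights"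
  obtains v where "v \<in> borel_measurable borel" "\<And>x. 0 < v x" "AE x in lborel. u x = v x"
    "AE y in lborel. \<forall>R>0.
      (\<integral>\<^sup>+x\<in>cball y R. ennreal (v x) \<partial>lborel) \<le> ennreal (enn2real (A1_const u) * (4 * R) ^ CARD('n) * v y)"
proof -
  have "u \<in> borel_measurable lebesgue"
    using u by (auto simp: A1_weights_def intro: weight_borel_measurable)
  then obtain u' where [measurable]: "u' \<in> borel_measurable lborel" and ae: "AE x in lborel. u x = u' x"
    using completion_ex_borel_measurable_real by blast
  define v where "v x = (if 0 < u' x then u' x else 1)" for x
  have ae2: "AE x in lborel. u x = v x"
    using ae A1_weight_pos[OF u, unfolded AE_completion_iff]
    by eventually_elim (auto simp: v_def)
  show thesis
  proof
    show "v \<in> borel_measurable borel" unfolding v_def by measurable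
    show "0 < v x" for x by (simp add: v_def)
    show "AE x in lborel. u x = v x" by fact
    have "(\<integral>\<^sup>+x\<in>cball y R. ennreal (u x) \<partial>lebesgue) = (\<integral>\<^sup>+x\<in>cball y R. ennreal (v x) \<partial>lborel)" for y R
      unfolding nn_integral_completion by (rule nn_integral_cong_AE) (use ae2 in \<open>eventually_elim, simp\<close>)
    note eq = this
    show "AE y in lborel. \<forall>R>0. (\<integral>\<^sup>+x\<in>cball y R. ennreal (v x) \<partial>lborel)
        \<le> ennreal (enn2real (A1_const u) * (4 * R) ^ CARD('n) * v y)"
      using A1_ball_bound[OF u, unfolded AE_completion_iff] ae2
      by eventually_elim (simp add: eq)
  qed
qed

text \<open>On the dyadic shell of radius \<open>R / 2 ^ k\<close> the kernel is comparable to a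
  constant and the mass of \<open>v\<close> is controlled by \<open>ball\<close>. The contributions
  form a geometric series of ratio \<open>2 powr (\<beta> - CARD('n))\<close>, which converges
  because \<beta> is below the dimension; bounding the kernel by its value at the inner edge of each
  shell costs \<open>2 powr \<beta>\<close>.\<close>

lemma nn_integral_kernel_ball:
  fixes v :: "real^'n \<Rightarrow> real" and A \<beta> R :: real
  assumes [measurable]: "v \<in> borel_measurable borel" and nn: "\<And>x. 0 \<le> v x" and A: "0 \<le> A"
    and \<beta>: "0 \<le> \<beta>" "\<beta> < CARD('n)" and R: "0 < R"
    and ball: "\<And>\<rho>. 0 < \<rho> \<Longrightarrow> (\<integral>\<^sup>+x\<in>cball y \<rho>. ennreal (v x) \<partial>lborel) \<le> ennreal (A * (4 * \<rho>) ^ CARD('n) * v y)"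
  shows "(\<integral>\<^sup>+x\<in>cball y R. ennreal (norm (x - y) powr (-\<beta>) * v x) \<partial>lborel)
    \<le> ennreal (4 ^ CARD('n) * 2 powr \<beta> / (1 - 2 powr (\<beta> - CARD('n))) * A * R powr (CARD('n) - \<beta>) * v y)"
proof -
  let ?n = "real CARD('n)"
  define \<rho> where "\<rho> = 2 powr (\<beta> - ?n)"
  have \<rho>: "0 < \<rho>" "\<rho> < 1" using \<beta> by (auto simp: \<rho>_def powr_less_one)
  define c where "c k = (R * (1/2) ^ Suc k) powr (-\<beta>)" for k :: nat
  have [measurable]: "cball y s \<in> sets borel" for s :: real by simp
  have cnn: "0 \<le> c k" for k by (simp add: c_def)
  \<comment> \<open>Compare the kernel with \<open>c k\<close> on the dyadic shell \<open>R / 2 ^ (k + 1) < norm (x - y) \<le> R / 2 ^ k\<close>;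
    at \<open>x = y\<close> the kernel is \<open>0 powr (-\<beta>) = 0\<close>.\<close>
  have pt: "ennreal (norm (x - y) powr (-\<beta>) * v x) * indicator (cball y R) x
    \<le> (\<Sum>k. ennreal (c k) * (ennreal (v x) * indicator (cball y (R * (1/2) ^ k)) x))" for x
  proof (cases "x \<in> cball y R \<and> x \<noteq> y")
    case True
    define d where "d = norm (x - y)"
    have d: "0 < d" "d \<le> R" using True by (auto simp: d_def dist_norm norm_minus_commute)
    \<comment> \<open>\<open>k\<close> is the first index whose radius drops below \<open>d\<close>.
      It is nonzero because \<open>d \<le> R\<close>, and its predecessor \<open>j\<close> is the
      index of the shell containing \<open>x\<close>.\<close>
    define k where "k = (LEAST k. R * (1/2) ^ k < d)"
    obtain k0 where "(1/2) ^ k0 < d / R"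
      using real_arch_pow_inv[of "d / R" "1/2"] d R by auto
    then have ex: "R * (1/2) ^ k0 < d" using R by (simp add: field_simps)
    then have k: "R * (1/2) ^ k < d" unfolding k_def by (rule LeastI)
    with d have "k \<noteq> 0" by (intro notI) simp
    then obtain j where j: "k = Suc j" by (cases k) auto
    have dj: "d \<le> R * (1/2) ^ j"
      using not_less_Least[of j "\<lambda>k. R * (1/2) ^ k < d"] j unfolding k_def[symmetric] by simp
    have "d powr (-\<beta>) \<le> c j"
      unfolding c_def using k R \<beta> unfolding j by (intro powr_mono2') auto
    then have *: "ennreal (d powr (-\<beta>) * v x) \<le> ennreal (c j * v x)"
      by (intro ennreal_leI mult_right_mono nn)
    have "ennreal (norm (x - y) powr (-\<beta>) * v x) * indicator (cball y R) x
      \<le> ennreal (c j) * (ennreal (v x) * indicator (cball y (R * (1/2) ^ j)) x)"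
    proof -
      have "x \<in> cball y (R * (1/2) ^ j)" using dj by (simp add: d_def dist_norm norm_minus_commute)
      then show ?thesis
        using True * cnn[of j] nn[of x] by (simp add: ennreal_mult d_def)
    qed
    also have "\<dots> \<le> (\<Sum>k. ennreal (c k) * (ennreal (v x) * indicator (cball y (R * (1/2) ^ k)) x))"
      using sum_le_suminf[of "\<lambda>k. ennreal (c k) * (ennreal (v x) * indicator (cball y (R * (1/2) ^ k)) x)" "{j}"] by simp
    finally show ?thesis .
  qed auto
  have ck: "c k * (A * (4 * (R * (1/2) ^ k)) ^ CARD('n) * v y) = 4 ^ CARD('n) * 2 powr \<beta> * A * R powr (?n - \<beta>) * v y * \<rho> ^ k" for k
  proof -
    have h: "(1/2::real) ^ m = 2 powr (- real m)" for m
      by (simp add: powr_minus powr_realpow power_one_over inverse_eq_divide)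
    have "c k = R powr (-\<beta>) * 2 powr (\<beta> * (1 + real k))"
      unfolding c_def h using R by (simp add: powr_mult powr_powr algebra_simps)
    also have "\<dots> = R powr (-\<beta>) * (2 powr \<beta> * 2 powr (\<beta> * real k))"
      by (simp add: distrib_left powr_add)
    finally have 1: "c k = R powr (-\<beta>) * (2 powr \<beta> * 2 powr (\<beta> * real k))" .
    have "((1/2::real) ^ k) ^ CARD('n) = 2 powr (- real k * ?n)"
      using h[of "k * CARD('n)"] by (simp add: power_mult)
    then have 2: "(4 * (R * (1/2) ^ k)) ^ CARD('n) = 4 ^ CARD('n) * (R powr ?n * 2 powr (- real k * ?n))"
      using R by (simp add: power_mult_distrib powr_realpow)
    have 3: "R powr (-\<beta>) * R powr ?n = R powr (?n - \<beta>)" by (simp add: powr_add[symmetric])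
    have 4: "2 powr (\<beta> * real k) * 2 powr (- real k * ?n) = \<rho> ^ k"
      by (simp add: \<rho>_def powr_powr powr_add[symmetric] powr_realpow[symmetric] algebra_simps)
    show ?thesis unfolding 1 2 3[symmetric] 4[symmetric] by (simp only: mult_ac)
  qed
  have "(\<integral>\<^sup>+x\<in>cball y R. ennreal (norm (x - y) powr (-\<beta>) * v x) \<partial>lborel)
    \<le> (\<integral>\<^sup>+x. (\<Sum>k. ennreal (c k) * (ennreal (v x) * indicator (cball y (R * (1/2) ^ k)) x)) \<partial>lborel)"
    by (rule nn_integral_mono) (rule pt)
  also have "\<dots> = (\<Sum>k. ennreal (c k) * (\<integral>\<^sup>+x\<in>cball y (R * (1/2) ^ k). ennreal (v x) \<partial>lborel))"
    by (subst nn_integral_suminf) (simp_all add: nn_integral_cmult)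
  also have "\<dots> \<le> (\<Sum>k. ennreal (c k) * ennreal (A * (4 * (R * (1/2) ^ k)) ^ CARD('n) * v y))"
    by (intro suminf_le mult_left_mono ball) (use R in auto)
  also have "\<dots> = (\<Sum>k. ennreal (4 ^ CARD('n) * 2 powr \<beta> * A * R powr (?n - \<beta>) * v y * \<rho> ^ k))"
    by (simp only: ennreal_mult'[OF cnn, symmetric] ck)
  also have "\<dots> = ennreal (4 ^ CARD('n) * 2 powr \<beta> * A * R powr (?n - \<beta>) * v y * (1 / (1 - \<rho>)))"
    using \<rho> A nn[of y] by (intro suminf_ennreal_eq sums_mult geometric_sums) auto
  finally show ?thesis by (simp add: \<rho>_def)
qed

section \<open>A potential estimate over outward directions\<close>

lemma nn_integral_lborel_affine:
  fixes h :: "'a::euclidean_space \<Rightarrow> ennreal" and s :: real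
  assumes [measurable]: "h \<in> borel_measurable borel" and s: "s > 0"
  shows "(\<integral>\<^sup>+v. h (x + s *\<^sub>R v) \<partial>lborel) = ennreal (s powr (- real DIM('a))) * (\<integral>\<^sup>+y. h y \<partial>lborel)"
proof -
  have "(\<integral>\<^sup>+y. h y \<partial>lborel) = (\<integral>\<^sup>+y. h y \<partial>density (distr lborel borel (\<lambda>v. x + s *\<^sub>R v)) (\<lambda>_. ennreal (\<bar>s\<bar> ^ DIM('a))))"
    using lborel_affine[of s x] s by simp
  also have "\<dots> = ennreal (s ^ DIM('a)) * (\<integral>\<^sup>+v. h (x + s *\<^sub>R v) \<partial>lborel)"
    using s by (simp add: nn_integral_density nn_integral_distr nn_integral_cmult)
  finally have "ennreal (s powr (- real DIM('a))) * (\<integral>\<^sup>+y. h y \<partial>lborel)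
    = ennreal (s powr (- real DIM('a))) * ennreal (s ^ DIM('a)) * (\<integral>\<^sup>+v. h (x + s *\<^sub>R v) \<partial>lborel)"
    by (simp add: mult.assoc)
  also have "ennreal (s powr (- real DIM('a))) * ennreal (s ^ DIM('a)) = 1"
    using s by (simp add: ennreal_mult[symmetric] powr_realpow[symmetric] powr_add[symmetric])
  finally show ?thesis by simp
qed

text \<open>Fundamental theorem of calculus along a ray that ends outside the support of
  \<open>F\<close>. The factor \<open>2\<close> bounds \<open>norm v\<close>; the time
  \<open>s = 0\<close>, a null set, is dropped so that \<open>y = x + s v\<close> is an invertible
  substitution in \<open>v\<close> later.\<close>

lemma abs_le_nn_integral_ray:
  fixes F :: "real^'n \<Rightarrow> real"
  assumes F: "\<And>x. GDERIV F x :> dF x" and cont: "continuous_on UNIV dF"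
    and supp: "\<And>x. norm x > R \<Longrightarrow> F x = 0" and v: "1 \<le> norm v" "norm v \<le> 2"
  shows "ennreal \<bar>F x\<bar> \<le> (\<integral>\<^sup>+s. (if 0 < s then ennreal (2 * norm (dF (x + s *\<^sub>R v))) else 0) \<partial>lborel)"
proof -
  \<comment> \<open>A time at which the ray has left the ball of radius \<open>R\<close>: since
    \<open>norm v \<ge> 1\<close>, the point reached has norm at least
    \<open>T - norm x\<close>.\<close>
  define T where "T = \<bar>R\<bar> + norm x + 1"
  have T: "T > 0" by (simp add: T_def add_nonneg_pos)
  have "norm (x + T *\<^sub>R v) \<ge> T * norm v - norm x"
    using norm_diff_ineq[of "T *\<^sub>R v" x] T by (simp add: add.commute)
  moreover have "T * norm v \<ge> T" using T v by simp
  ultimately have "norm (x + T *\<^sub>R v) > R" by (simp add: T_def)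
  then have FT: "F (x + T *\<^sub>R v) = 0" by (rule supp)
  have cont': "continuous_on S (\<lambda>s. dF (x + s *\<^sub>R v))" for S
    by (rule continuous_on_compose2[OF cont]) (auto intro!: continuous_intros)
  have "((\<lambda>s. F (x + s *\<^sub>R v)) has_vector_derivative (v \<bullet> dF (x + s *\<^sub>R v))) (at s within {0..T})" for s
  proof -
    have 1: "(F has_derivative (\<lambda>h. h \<bullet> dF (x + s *\<^sub>R v))) (at (x + s *\<^sub>R v))"
      using F unfolding gderiv_def .
    have 2: "((\<lambda>s. x + s *\<^sub>R v) has_derivative (\<lambda>h. h *\<^sub>R v)) (at s within {0..T})"
      by (auto intro!: derivative_eq_intros)
    show ?thesis
      using has_derivative_compose[OF 2 1] by (simp add: has_vector_derivative_def)
  qed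
  then have "((\<lambda>s. v \<bullet> dF (x + s *\<^sub>R v)) has_integral (F (x + T *\<^sub>R v) - F (x + 0 *\<^sub>R v))) {0..T}"
    using T by (intro fundamental_theorem_of_calculus) auto
  then have int: "((\<lambda>s. v \<bullet> dF (x + s *\<^sub>R v)) has_integral (- F x)) {0..T}"
    by (simp add: FT)
  define I where "I = integral {0..T} (\<lambda>s. 2 * norm (dF (x + s *\<^sub>R v)))"
  have I: "((\<lambda>s. 2 * norm (dF (x + s *\<^sub>R v))) has_integral I) {0..T}"
    unfolding I_def by (intro integrable_integral integrable_continuous_real continuous_intros cont')
  have "norm (integral {0..T} (\<lambda>s. v \<bullet> dF (x + s *\<^sub>R v))) \<le> I"
    unfolding I_def
  proof (rule integral_norm_bound_integral)
    fix s assume "s \<in> {0..T}"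
    have "norm (v \<bullet> dF (x + s *\<^sub>R v)) \<le> norm v * norm (dF (x + s *\<^sub>R v))"
      by (simp add: Cauchy_Schwarz_ineq2)
    also have "\<dots> \<le> 2 * norm (dF (x + s *\<^sub>R v))" using v by (intro mult_right_mono) auto
    finally show "norm (v \<bullet> dF (x + s *\<^sub>R v)) \<le> 2 * norm (dF (x + s *\<^sub>R v))" .
  qed (use int I in \<open>auto simp: has_integral_integrable_integral\<close>)
  then have "\<bar>F x\<bar> \<le> I" using int by (simp add: integral_unique)
  then have "ennreal \<bar>F x\<bar> \<le> ennreal I" by (rule ennreal_leI)
  also have "\<dots> = (\<integral>\<^sup>+s. ennreal (2 * norm (dF (x + s *\<^sub>R v))) * indicator {0..T} s \<partial>lborel)"
    by (rule nn_integral_has_integral_lebesgue'[symmetric, OF _ I]) simp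
  also have "\<dots> \<le> (\<integral>\<^sup>+s. (if 0 < s then ennreal (2 * norm (dF (x + s *\<^sub>R v))) else 0) \<partial>lborel)"
    by (intro nn_integral_mono_AE) (use AE_lborel_singleton[of 0] in \<open>eventually_elim, auto simp: indicator_def\<close>)
  finally show ?thesis .
qed

text \<open>The conditions confine \<open>s\<close> to an interval of length \<open>d/2\<close> on
  which the integrand is at most its value at \<open>d/2\<close>. With \<open>m\<close> the
  dimension and \<open>d = norm (x - y)\<close>, this time integral produces the kernel of the
  potential.\<close>

lemma nn_integral_dyadic_powr_le:
  fixes d m :: real
  assumes d: "0 \<le> d" and m: "0 \<le> m"
  shows "(\<integral>\<^sup>+s. (if 0 < s \<and> s \<le> d \<and> d \<le> 2 * s then ennreal (s powr (-m)) else 0) \<partial>lborel)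
    \<le> ennreal (2 powr (m - 1) * d powr (1 - m))"
proof -
  have "(\<integral>\<^sup>+s. (if 0 < s \<and> s \<le> d \<and> d \<le> 2 * s then ennreal (s powr (-m)) else 0) \<partial>lborel)
    \<le> (\<integral>\<^sup>+s. ennreal ((d/2) powr (-m)) * indicator {d/2..d} s \<partial>lborel)"
  proof (rule nn_integral_mono)
    fix s
    have "s powr (-m) \<le> (d/2) powr (-m)" if "0 < s" "s \<le> d" "d \<le> 2 * s"
      using that m by (intro powr_mono2') auto
    then show "(if 0 < s \<and> s \<le> d \<and> d \<le> 2 * s then ennreal (s powr (-m)) else 0) \<le> ennreal ((d/2) powr (-m)) * indicator {d/2..d} s"
      by (auto intro!: ennreal_leI simp: indicator_def)
  qed
  also have "\<dots> = ennreal ((d/2) powr (-m)) * ennreal (d/2)"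
    using d by (simp add: nn_integral_cmult_indicator)
  also have "\<dots> = ennreal ((d/2) powr (-m) * (d/2))"
    by (rule ennreal_mult''[symmetric]) (use d in simp)
  also have "(d/2) powr (-m) * (d/2) = (d/2) powr (1 - m)"
  proof (cases "d = 0")
    case False
    then have "(d/2) powr (-m) * (d/2) powr 1 = (d/2) powr (1 - m)" by (simp only: powr_add[symmetric] add.commute diff_conv_add_uminus)
    with d show ?thesis by simp
  qed simp
  also have "(d/2) powr (1 - m) = 2 powr (m - 1) * d powr (1 - m)"
  proof -
    have "2 powr (m - 1) * 2 powr (1 - m) = (1::real)" by (simp add: powr_add[symmetric])
    then show ?thesis using d by (simp add: powr_divide field_simps)
  qed
  finally show ?thesis .
qed

section \<open>Averaging over a half annulus of outward directions\<close>

interpretation lborel_pair: pair_sigma_finite "lborel :: 'a::euclidean_space measure" "lborel :: 'b::euclidean_space measure" ..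

text \<open>The half annulus and its reflection through the origin cover the annulus, and reflection
  preserves Lebesgue measure. The directions pointing away from the origin as seen from
  \<open>x\<close> thus have measure bounded below uniformly in \<open>x\<close>.\<close>

lemma emeasure_annulus_le_half:
  fixes x :: "real^'n"
  shows "emeasure lborel {v::real^'n. 1 \<le> norm v \<and> norm v \<le> 2} \<le> 2 * emeasure lborel {v. 1 \<le> norm v \<and> norm v \<le> 2 \<and> 0 \<le> v \<bullet> x}"
proof -
  let ?A = "{v::real^'n. 1 \<le> norm v \<and> norm v \<le> 2}" and ?H = "{v. 1 \<le> norm v \<and> norm v \<le> 2 \<and> 0 \<le> v \<bullet> x}"
  have [measurable]: "?A \<in> sets lborel" "?H \<in> sets lborel" by measurable
  have "(lborel :: (real^'n) measure) = distr lborel borel uminus"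
    using lborel_affine[of "-1" "0::real^'n"] by (simp add: density_1 one_ennreal_def[symmetric] scaleR_minus1_left)
  then have "emeasure lborel ?H = emeasure (distr lborel borel uminus) ?H" by simp
  also have "\<dots> = emeasure lborel (uminus -` ?H)" by (subst emeasure_distr) auto
  finally have eq: "emeasure lborel (uminus -` ?H) = emeasure lborel ?H" by simp
  have "emeasure lborel ?A \<le> emeasure lborel (?H \<union> uminus -` ?H)"
    by (rule emeasure_mono) auto
  also have "\<dots> \<le> emeasure lborel ?H + emeasure lborel (uminus -` ?H)"
    by (rule emeasure_subadditive) (auto intro: measurable_sets_borel[of uminus borel])
  finally show ?thesis unfolding eq mult_2 .
qed

lemma annulus_finite_pos:
  shows "emeasure lborel {v::real^'n. 1 \<le> norm v \<and> norm v \<le> 2} < \<infinity>"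
    and "0 < emeasure lborel {v::real^'n. 1 \<le> norm v \<and> norm v \<le> 2}"
proof -
  let ?A = "{v::real^'n. 1 \<le> norm v \<and> norm v \<le> 2}"
  have [measurable]: "?A \<in> sets lborel" by measurable
  have "emeasure lborel ?A \<le> emeasure lborel (cball (0::real^'n) 2)"
    by (rule emeasure_mono) auto
  also have "\<dots> < \<infinity>" by (rule emeasure_lborel_cball_finite)
  finally show "emeasure lborel ?A < \<infinity>" .
  obtain e :: "real^'n" where e: "norm e = 1" using vector_choose_size[of 1] by auto
  have "ball ((3/2) *\<^sub>R e) (1/2) \<subseteq> ?A"
  proof
    fix v assume "v \<in> ball ((3/2) *\<^sub>R e) (1/2)"
    then have "norm ((3/2) *\<^sub>R e - v) < 1/2" by (simp add: dist_norm)
    moreover have "norm ((3/2) *\<^sub>R e) = 3/2" using e by simp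
    ultimately show "v \<in> ?A"
      using norm_triangle_ineq2[of "(3/2) *\<^sub>R e" v] norm_triangle_ineq2[of v "(3/2) *\<^sub>R e"]
      by (simp add: norm_minus_commute)
  qed
  then have "emeasure lborel (ball ((3/2) *\<^sub>R e) (1/2)) \<le> emeasure lborel ?A"
    by (rule emeasure_mono) simp
  moreover have "0 < emeasure lborel (ball ((3/2) *\<^sub>R e) (1/2))"
    using content_ball_pos[of "1/2" "(3/2) *\<^sub>R e"] emeasure_lborel_ball_finite[of "(3/2) *\<^sub>R e" "1/2"]
    by (simp add: emeasure_eq_ennreal_measure)
  ultimately show "0 < emeasure lborel ?A" by order
qed

text \<open>The ray bound is averaged over outward \<open>v\<close>, the integrals are exchanged,
  and \<open>y = x + s v\<close> is substituted for fixed \<open>s\<close>. A solid annulus replaces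
  the sphere, so no surface measure is needed: each \<open>y\<close> is reached for \<open>s\<close>
  between half of \<open>norm (x - y)\<close> and \<open>norm (x - y)\<close>, and integrating over
  these \<open>s\<close> leaves the kernel. \<open>K\<close> is fixed before \<open>F\<close> and
  depends only on the dimension.\<close>

lemma outward_potential_bound:
  obtains K where "K > 0"
    "\<And>(F :: real^'n \<Rightarrow> real) dF R x. (\<And>x. GDERIV F x :> dF x) \<Longrightarrow> continuous_on UNIV dF \<Longrightarrow>
      (\<And>x. norm x > R \<Longrightarrow> F x = 0) \<Longrightarrow>
      ennreal \<bar>F x\<bar> \<le> ennreal K *
        (\<integral>\<^sup>+y. ennreal (norm (dF y) * (norm (x - y) powr (1 - real CARD('n)) * of_bool (norm x \<le> norm y))) \<partial>lborel)"
proof -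
  let ?A = "{v::real^'n. 1 \<le> norm v \<and> norm v \<le> 2}"
  let ?n = "real CARD('n)"
  define a where "a = measure lborel ?A"
  have A: "emeasure lborel ?A = ennreal a"
    unfolding a_def using annulus_finite_pos(1)[where 'n='n] by (intro emeasure_eq_ennreal_measure) auto
  then have a: "a > 0" using annulus_finite_pos(2)[where 'n='n] by simp
  \<comment> \<open>The factors come, in order, from the half annulus, from
    \<open>norm v \<le> 2\<close>, from the time integral, and from dividing by the measure of the
    annulus.\<close>
  define K where "K = 2 * (2 * 2 powr (?n - 1)) / a"
  show thesis
  proof (rule that[of K])
    show "K > 0" using a by (simp add: K_def)
    fix F :: "real^'n \<Rightarrow> real" and dF R and x :: "real^'n"
    assume F: "\<And>x. GDERIV F x :> dF x" "continuous_on UNIV dF" "\<And>x. norm x > R \<Longrightarrow> F x = 0"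
    have [measurable]: "dF \<in> borel_measurable borel"
      using F(2) by (rule borel_measurable_continuous_onI)
    define H where "H v \<longleftrightarrow> 1 \<le> norm v \<and> norm v \<le> 2 \<and> 0 \<le> v \<bullet> x" for v
    have [measurable]: "Measurable.pred borel H" unfolding H_def by measurable
    define k where "k y = norm (x - y) powr (1 - ?n) * of_bool (norm x \<le> norm y)" for y
    have "ennreal a * ennreal \<bar>F x\<bar> \<le> 2 * (emeasure lborel {v. H v} * ennreal \<bar>F x\<bar>)"
      unfolding A[symmetric] mult.assoc[symmetric] H_def by (rule mult_right_mono[OF emeasure_annulus_le_half]) simp
    also have "emeasure lborel {v. H v} * ennreal \<bar>F x\<bar> = (\<integral>\<^sup>+v. ennreal \<bar>F x\<bar> * indicator {v. H v} v \<partial>lborel)"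
      by (subst nn_integral_cmult_indicator) (auto simp: mult.commute)
    also have "\<dots> \<le> (\<integral>\<^sup>+v. (\<integral>\<^sup>+s. (if 0 < s \<and> H v then ennreal (2 * norm (dF (x + s *\<^sub>R v))) else 0) \<partial>lborel) \<partial>lborel)"
    proof (rule nn_integral_mono)
      fix v
      show "ennreal \<bar>F x\<bar> * indicator {v. H v} v \<le> (\<integral>\<^sup>+s. (if 0 < s \<and> H v then ennreal (2 * norm (dF (x + s *\<^sub>R v))) else 0) \<partial>lborel)"
        using abs_le_nn_integral_ray[OF F, where v = v and x = x] by (cases "H v") (auto simp: H_def)
    qed
    also have "\<dots> = (\<integral>\<^sup>+s. (\<integral>\<^sup>+v. (if 0 < s \<and> H v then ennreal (2 * norm (dF (x + s *\<^sub>R v))) else 0) \<partial>lborel) \<partial>lborel)"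
      by (rule lborel_pair.Fubini') measurable
    also have "\<dots> \<le> (\<integral>\<^sup>+s. (\<integral>\<^sup>+y. ennreal (2 * norm (dF y) * of_bool (norm x \<le> norm y)) *
        (if 0 < s \<and> s \<le> norm (x - y) \<and> norm (x - y) \<le> 2 * s then ennreal (s powr (-?n)) else 0) \<partial>lborel) \<partial>lborel)"
    proof (rule nn_integral_mono)
      fix s :: real
      show "(\<integral>\<^sup>+v. (if 0 < s \<and> H v then ennreal (2 * norm (dF (x + s *\<^sub>R v))) else 0) \<partial>lborel)
        \<le> (\<integral>\<^sup>+y. ennreal (2 * norm (dF y) * of_bool (norm x \<le> norm y)) *
        (if 0 < s \<and> s \<le> norm (x - y) \<and> norm (x - y) \<le> 2 * s then ennreal (s powr (-?n)) else 0) \<partial>lborel)"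
      proof (cases "0 < s")
        case s: True
        have "(\<integral>\<^sup>+v. (if 0 < s \<and> H v then ennreal (2 * norm (dF (x + s *\<^sub>R v))) else 0) \<partial>lborel)
          = (\<integral>\<^sup>+v. (\<lambda>y. if H ((1/s) *\<^sub>R (y - x)) then ennreal (2 * norm (dF y)) else 0) (x + s *\<^sub>R v) \<partial>lborel)"
          using s by (intro nn_integral_cong) simp
        also have "\<dots> = ennreal (s powr (-?n)) * (\<integral>\<^sup>+y. (if H ((1/s) *\<^sub>R (y - x)) then ennreal (2 * norm (dF y)) else 0) \<partial>lborel)"
          by (subst nn_integral_lborel_affine[OF _ s]) simp_all
        also have "\<dots> = (\<integral>\<^sup>+y. ennreal (s powr (-?n)) * (if H ((1/s) *\<^sub>R (y - x)) then ennreal (2 * norm (dF y)) else 0) \<partial>lborel)"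
          by (subst nn_integral_cmult) simp_all
        also have "\<dots> \<le> (\<integral>\<^sup>+y. ennreal (2 * norm (dF y) * of_bool (norm x \<le> norm y)) *
          (if 0 < s \<and> s \<le> norm (x - y) \<and> norm (x - y) \<le> 2 * s then ennreal (s powr (-?n)) else 0) \<partial>lborel)"
        proof (rule nn_integral_mono)
          fix y
          \<comment> \<open>With \<open>y - x = s v\<close>, the sign condition on \<open>v\<close>
            gives \<open>x \<bullet> x \<le> y \<bullet> x\<close>, and Cauchy-Schwarz turns this
            into \<open>norm x \<le> norm y\<close>.\<close>
          have "s \<le> norm (x - y) \<and> norm (x - y) \<le> 2 * s \<and> norm x \<le> norm y" if "H ((1/s) *\<^sub>R (y - x))"
          proof -
            have 1: "1 \<le> norm (x - y) / s" "norm (x - y) / s \<le> 2" and 2: "0 \<le> (y - x) \<bullet> x"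
              using that s by (auto simp: H_def norm_minus_commute zero_le_divide_iff)
            have "norm x * norm x \<le> y \<bullet> x" using 2 by (simp add: inner_diff_left dot_square_norm power2_eq_square)
            also have "\<dots> \<le> norm y * norm x" by (rule norm_cauchy_schwarz)
            finally have "norm x \<le> norm y" by (cases "x = 0") auto
            with 1 s show ?thesis by (simp add: field_simps)
          qed
          then show "ennreal (s powr (-?n)) * (if H ((1/s) *\<^sub>R (y - x)) then ennreal (2 * norm (dF y)) else 0)
            \<le> ennreal (2 * norm (dF y) * of_bool (norm x \<le> norm y)) *
             (if 0 < s \<and> s \<le> norm (x - y) \<and> norm (x - y) \<le> 2 * s then ennreal (s powr (-?n)) else 0)"
            using s by (auto simp: mult.commute)
        qed
        finally show ?thesis .
      qed simp
    qed
    also have "\<dots> = (\<integral>\<^sup>+y. (\<integral>\<^sup>+s. ennreal (2 * norm (dF y) * of_bool (norm x \<le> norm y)) *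
        (if 0 < s \<and> s \<le> norm (x - y) \<and> norm (x - y) \<le> 2 * s then ennreal (s powr (-?n)) else 0) \<partial>lborel) \<partial>lborel)"
      by (rule lborel_pair.Fubini') measurable
    also have "\<dots> = (\<integral>\<^sup>+y. ennreal (2 * norm (dF y) * of_bool (norm x \<le> norm y)) * (\<integral>\<^sup>+s.
        (if 0 < s \<and> s \<le> norm (x - y) \<and> norm (x - y) \<le> 2 * s then ennreal (s powr (-?n)) else 0) \<partial>lborel) \<partial>lborel)"
      by (subst nn_integral_cmult) simp_all
    also have "\<dots> \<le> (\<integral>\<^sup>+y. ennreal (2 * norm (dF y) * of_bool (norm x \<le> norm y)) *
        ennreal (2 powr (?n - 1) * norm (x - y) powr (1 - ?n)) \<partial>lborel)"
      by (intro nn_integral_mono mult_left_mono nn_integral_dyadic_powr_le) auto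
    also have "\<dots> = (\<integral>\<^sup>+y. ennreal (2 * 2 powr (?n - 1)) * ennreal (norm (dF y) * k y) \<partial>lborel)"
      by (intro nn_integral_cong) (simp add: k_def ennreal_mult'[symmetric] mult_ac)
    also have "\<dots> = ennreal (2 * 2 powr (?n - 1)) * (\<integral>\<^sup>+y. ennreal (norm (dF y) * k y) \<partial>lborel)"
      unfolding k_def by (subst nn_integral_cmult) simp_all
    finally have *: "ennreal a * ennreal \<bar>F x\<bar> \<le> 2 * (ennreal (2 * 2 powr (?n - 1)) * (\<integral>\<^sup>+y. ennreal (norm (dF y) * k y) \<partial>lborel))"
      by (simp add: mult_left_mono)
    have "ennreal \<bar>F x\<bar> = ennreal (1 / a) * (ennreal a * ennreal \<bar>F x\<bar>)"
      using a by (simp add: ennreal_mult'[symmetric])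
    also have "\<dots> \<le> ennreal (1 / a) * (ennreal 2 * (ennreal (2 * 2 powr (?n - 1)) * (\<integral>\<^sup>+y. ennreal (norm (dF y) * k y) \<partial>lborel)))"
      using * by (intro mult_left_mono) simp_all
    also have "\<dots> = ennreal K * (\<integral>\<^sup>+y. ennreal (norm (dF y) * k y) \<partial>lborel)"
    proof -
      have "K = 1 / a * (2 * (2 * 2 powr (?n - 1)))" by (simp add: K_def)
      then have "ennreal K = ennreal (1 / a) * (ennreal 2 * ennreal (2 * 2 powr (?n - 1)))"
        using a by (simp only:, subst ennreal_mult, simp, simp, subst ennreal_mult) simp_all
      then show ?thesis by (simp only: mult.assoc)
    qed
    finally show "ennreal \<bar>F x\<bar> \<le> ennreal K *
      (\<integral>\<^sup>+y. ennreal (norm (dF y) * (norm (x - y) powr (1 - ?n) * of_bool (norm x \<le> norm y))) \<partial>lborel)"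
      by (simp add: k_def)
  qed
qed

section \<open>The weighted Sobolev inequality\<close>

text \<open>Makes powers of a truncated function continuously differentiable. At the kink the
  difference quotient is at most \<open>\<bar>h\<bar> powr (\<gamma> - 1)\<close>, which tends to
  zero since \<gamma> exceeds 1.\<close>

lemma has_real_derivative_max_powr:
  fixes x \<gamma> :: real
  assumes \<gamma>: "1 < \<gamma>"
  shows "((\<lambda>x. max 0 x powr \<gamma>) has_real_derivative \<gamma> * max 0 x powr (\<gamma> - 1)) (at x)"
proof -
  consider "x > 0" | "x < 0" | "x = 0" by linarith
  then show ?thesis
  proof cases
    case 1
    have "((\<lambda>x. x powr \<gamma>) has_real_derivative \<gamma> * x powr (\<gamma> - 1)) (at x)"
      using 1 by (auto intro!: derivative_eq_intros)
    then have "((\<lambda>x. max 0 x powr \<gamma>) has_real_derivative \<gamma> * x powr (\<gamma> - 1)) (at x)"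
      by (rule DERIV_cong_ev[THEN iffD1, rotated -1, OF _ refl _ refl])
        (use eventually_nhds_in_open[of "{0<..}" x] 1 in \<open>auto elim!: eventually_mono\<close>)
    then show ?thesis using 1 by simp
  next
    case 2
    have "((\<lambda>x. 0) has_real_derivative 0) (at x)" by simp
    then have "((\<lambda>x. max 0 x powr \<gamma>) has_real_derivative 0) (at x)"
      by (rule DERIV_cong_ev[THEN iffD1, rotated -1, OF _ refl _ refl])
        (use eventually_nhds_in_open[of "{..<0}" x] 2 in \<open>auto elim!: eventually_mono\<close>)
    then show ?thesis using 2 by simp
  next
    case 3
    have "((\<lambda>h. max 0 h powr \<gamma> / h) \<longlongrightarrow> 0) (at 0)"
    proof (rule Lim_null_comparison)
      have "norm (max 0 h powr \<gamma> / h) \<le> \<bar>h\<bar> powr (\<gamma> - 1)" for h :: real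
      proof (cases "h > 0")
        case True
        then have "h powr \<gamma> = h powr (\<gamma> - 1) * h"
          using powr_add[of h "\<gamma> - 1" 1] by simp
        with True show ?thesis by simp
      qed simp
      then show "\<forall>\<^sub>F h in at 0. norm (max 0 h powr \<gamma> / h) \<le> \<bar>h\<bar> powr (\<gamma> - 1)" by simp
      show "((\<lambda>h::real. \<bar>h\<bar> powr (\<gamma> - 1)) \<longlongrightarrow> 0) (at 0)"
      proof (rule tendsto_zero_powrI)
        show "((\<lambda>h::real. \<bar>h\<bar>) \<longlongrightarrow> 0) (at 0)" by (rule tendsto_rabs_zero) (rule tendsto_ident_at)
        show "((\<lambda>h. \<gamma> - 1) \<longlongrightarrow> \<gamma> - 1) (at 0)" by simp
      qed (use \<gamma> in auto)
    qed
    then show ?thesis using 3 by (simp add: DERIV_def)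
  qed
qed

text \<open>Jensen for the measure with density \<open>m = norm (dF y) * W y\<close> moves the power
  \<open>r\<close> inside the potential. After Fubini, the inner integral over \<open>x\<close> is
  bounded uniformly in \<open>y\<close> by the kernel estimate, which plays the part of Minkowski's
  inequality. \<open>K\<close> is chosen before the weight and \<open>F\<close>, and
  \<open>A\<close> enters linearly.\<close>

lemma weighted_L1_sobolev:
  fixes \<Theta> r :: real
  assumes r: "1 \<le> r" and \<Theta>: "0 < \<Theta>" and nr: "real CARD('n) = (real CARD('n) - 1 + \<Theta>) * r"
  obtains K where "K > 0"
    "\<And>(v :: real^'n \<Rightarrow> real) A F dF R I.
    v \<in> borel_measurable borel \<Longrightarrow> (\<And>x. 0 < v x) \<Longrightarrow> 0 \<le> A \<Longrightarrow>
    (AE y in lborel. \<forall>\<rho>>0. (\<integral>\<^sup>+x\<in>cball y \<rho>. ennreal (v x) \<partial>lborel) \<le> ennreal (A * (4 * \<rho>) ^ CARD('n) * v y)) \<Longrightarrow>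
    (\<And>x. GDERIV F x :> dF x) \<Longrightarrow> continuous_on UNIV dF \<Longrightarrow> (\<And>x. norm x > R \<Longrightarrow> F x = 0) \<Longrightarrow> 0 \<le> I \<Longrightarrow>
    (\<integral>\<^sup>+y. ennreal (norm (dF y) * (norm y powr \<Theta> * v y powr (1/r))) \<partial>lborel) \<le> ennreal I \<Longrightarrow>
    (\<integral>\<^sup>+x. ennreal (\<bar>F x\<bar> powr r * v x) \<partial>lborel) \<le> ennreal (K * A * I powr r)"
proof -
  let ?n = "real CARD('n)"
  obtain K0 where K0: "K0 > 0" and rep: "\<And>(F :: real^'n \<Rightarrow> real) dF R x. (\<And>x. GDERIV F x :> dF x) \<Longrightarrow> continuous_on UNIV dF \<Longrightarrow>
      (\<And>x. norm x > R \<Longrightarrow> F x = 0) \<Longrightarrow> ennreal \<bar>F x\<bar> \<le> ennreal K0 *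
      (\<integral>\<^sup>+y. ennreal (norm (dF y) * (norm (x - y) powr (1 - ?n) * of_bool (norm x \<le> norm y))) \<partial>lborel)"
    by (rule outward_potential_bound[where 'n='n]) blast
  \<comment> \<open>Order of the singularity of the kernel raised to the power \<open>r\<close>. The
    relation \<open>nr\<close> says exactly that \<open>?n - \<beta> = \<Theta> * r\<close>, the
    homogeneity that lets the kernel integral cancel against \<open>W y powr r\<close>.\<close>
  define \<beta> where "\<beta> = (?n - 1) * r"
  have \<beta>: "0 \<le> \<beta>" "\<beta> < ?n" and n\<beta>: "?n - \<beta> = \<Theta> * r"
  proof -
    show "0 \<le> \<beta>" using r by (simp add: \<beta>_def Suc_leI)
    show eq: "?n - \<beta> = \<Theta> * r" using nr by (simp add: \<beta>_def algebra_simps)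
    have "0 < \<Theta> * r" using \<Theta> r by simp
    with eq show "\<beta> < ?n" by linarith
  qed
  define K1 where "K1 = 4 ^ CARD('n) * 2 powr \<beta> / (1 - 2 powr (\<beta> - ?n))"
  have K1: "K1 > 0" using \<beta> by (simp add: K1_def powr_less_one)
  define K where "K = K0 powr r * (K1 * 2 powr (\<Theta> * r))"
  show thesis
  proof (rule that[of K])
    show "K > 0" using K0 K1 by (simp add: K_def)
    fix v F :: "real^'n \<Rightarrow> real" and A dF R I
    assume v[measurable]: "v \<in> borel_measurable borel" and vpos: "\<And>x. 0 < v x" and A: "0 \<le> A"
      and ball: "AE y in lborel. \<forall>\<rho>>0. (\<integral>\<^sup>+x\<in>cball y \<rho>. ennreal (v x) \<partial>lborel) \<le> ennreal (A * (4 * \<rho>) ^ CARD('n) * v y)"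
      and F: "\<And>x. GDERIV F x :> dF x" and dF: "continuous_on UNIV dF" and supp: "\<And>x. norm x > R \<Longrightarrow> F x = 0"
      and I: "0 \<le> I" and le: "(\<integral>\<^sup>+y. ennreal (norm (dF y) * (norm y powr \<Theta> * v y powr (1/r))) \<partial>lborel) \<le> ennreal I"
    have [measurable]: "dF \<in> borel_measurable borel"
      using dF by (rule borel_measurable_continuous_onI)
    have Fc: "continuous_on UNIV F"
      using F by (auto intro!: has_derivative_continuous_on[where f'="\<lambda>x h. h \<bullet> dF x"] simp: gderiv_def intro: has_derivative_at_withinI)
    then have [measurable]: "F \<in> borel_measurable borel"
      by (rule borel_measurable_continuous_onI)
    define W where "W y = norm y powr \<Theta> * v y powr (1/r)" for y
    have [measurable]: "W \<in> borel_measurable borel" unfolding W_def by measurable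
    have W0: "0 \<le> W y" for y by (simp add: W_def)
    have Wr: "W y powr r = norm y powr (\<Theta> * r) * v y" for y
      using r vpos[of y] by (simp add: W_def powr_mult powr_powr)
    define k where "k x y = norm (x - y) powr (1 - ?n) * of_bool (norm x \<le> norm y)" for x y :: "real^'n"
    have [measurable]: "(\<lambda>z. k (fst z) (snd z)) \<in> borel_measurable (borel \<Otimes>\<^sub>M borel)" unfolding k_def by measurable
    have k0: "0 \<le> k x y" for x y by (simp add: k_def)
    have [measurable]: "(\<lambda>y. k x y) \<in> borel_measurable borel" "(\<lambda>x. k x y) \<in> borel_measurable borel" for x y unfolding k_def by measurable
    define m where "m y = norm (dF y) * W y" for y
    have [measurable]: "m \<in> borel_measurable borel" unfolding m_def by measurable
    have [measurable]: "cball y s \<in> sets borel" for y :: "real^'n" and s by simp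
    have m0: "0 \<le> m y" for y by (simp add: m_def W0)
    have mI: "(\<integral>\<^sup>+y. ennreal (m y) \<partial>lborel) \<le> ennreal I" using le by (simp add: m_def W_def)
    have ptw: "ennreal (\<bar>F x\<bar> powr r) \<le> ennreal (K0 powr r * I powr (r - 1)) * (\<integral>\<^sup>+y. ennreal ((k x y / W y) powr r * m y) \<partial>lborel)" for x
    proof -
      have "ennreal (\<bar>F x\<bar> / K0) \<le> (\<integral>\<^sup>+y. ennreal (norm (dF y) * k x y) \<partial>lborel)"
      proof -
        have "ennreal (\<bar>F x\<bar> / K0) = ennreal (1 / K0) * ennreal \<bar>F x\<bar>"
          using K0 by (simp add: ennreal_mult'[symmetric])
        also have "\<dots> \<le> ennreal (1 / K0) * (ennreal K0 * (\<integral>\<^sup>+y. ennreal (norm (dF y) * k x y) \<partial>lborel))"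
          unfolding k_def using F dF supp by (intro mult_left_mono rep[of F dF R]) auto
        also have "\<dots> = (\<integral>\<^sup>+y. ennreal (norm (dF y) * k x y) \<partial>lborel)"
          using K0 unfolding mult.assoc[symmetric] by (simp add: ennreal_mult'[symmetric])
        finally show ?thesis .
      qed
      \<comment> \<open>Since \<open>v\<close> is positive, \<open>W\<close> vanishes only at the
        origin, so dividing by it is legitimate almost everywhere.\<close>
      also have "\<dots> = (\<integral>\<^sup>+y. ennreal (k x y / W y * m y) \<partial>lborel)"
      proof (rule nn_integral_cong_AE)
        show "AE y in lborel. ennreal (norm (dF y) * k x y) = ennreal (k x y / W y * m y)"
          using AE_lborel_singleton[of "0::real^'n"]
        proof eventually_elim
          case (elim y)
          then have "W y \<noteq> 0" using vpos[of y] by (simp add: W_def)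
          then show ?case by (simp add: m_def mult.commute)
        qed
      qed
      finally have "ennreal ((\<bar>F x\<bar> / K0) powr r) \<le> ennreal (I powr (r - 1)) * (\<integral>\<^sup>+y. ennreal ((k x y / W y) powr r * m y) \<partial>lborel)"
        using r I K0 mI by (intro nn_integral_Jensen_powr) (auto simp: W0 k0 m0)
      then have "ennreal (K0 powr r) * ennreal ((\<bar>F x\<bar> / K0) powr r) \<le> ennreal (K0 powr r) * (ennreal (I powr (r - 1)) * (\<integral>\<^sup>+y. ennreal ((k x y / W y) powr r * m y) \<partial>lborel))"
        by (intro mult_left_mono) auto
      moreover have "ennreal (K0 powr r) * ennreal ((\<bar>F x\<bar> / K0) powr r) = ennreal (\<bar>F x\<bar> powr r)"
        using K0 by (simp add: ennreal_mult'[symmetric] powr_divide)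
      ultimately show ?thesis by (simp add: ennreal_mult mult.assoc)
    qed
    \<comment> \<open>Where \<open>norm x \<le> norm y\<close>, the point \<open>x\<close> lies
      within \<open>2 * norm y\<close> of \<open>y\<close>. The kernel estimate with that radius
      gives \<open>(2 * norm y) powr (\<Theta> * r) * v y\<close> up to constants, which is
      \<open>W y powr r\<close> times \<open>2 powr (\<Theta> * r)\<close>.\<close>
    have ker: "AE y in lborel. (\<integral>\<^sup>+x. ennreal ((k x y / W y) powr r * v x) \<partial>lborel) \<le> ennreal (K1 * A * 2 powr (\<Theta> * r))"
      using ball AE_lborel_singleton[of "0::real^'n"]
    proof eventually_elim
      case (elim y)
      then have y: "norm y > 0" by simp
      then have W: "W y > 0" using vpos[of y] by (simp add: W_def)
      have "(\<integral>\<^sup>+x. ennreal ((k x y / W y) powr r * v x) \<partial>lborel)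
        \<le> (\<integral>\<^sup>+x. ennreal (1 / W y powr r) * (ennreal (norm (x - y) powr (-\<beta>) * v x) * indicator (cball y (2 * norm y)) x) \<partial>lborel)"
      proof (rule nn_integral_mono)
        fix x
        show "ennreal ((k x y / W y) powr r * v x) \<le> ennreal (1 / W y powr r) * (ennreal (norm (x - y) powr (-\<beta>) * v x) * indicator (cball y (2 * norm y)) x)"
        proof (cases "norm x \<le> norm y")
          case True
          then have "x \<in> cball y (2 * norm y)"
            using norm_triangle_ineq4[of y x] by (simp add: dist_norm)
          moreover have "(k x y / W y) powr r = norm (x - y) powr (-\<beta>) / W y powr r"
            using True W by (simp add: k_def powr_divide powr_powr \<beta>_def algebra_simps)
          ultimately show ?thesis using W vpos[of x] by (simp add: ennreal_mult[symmetric])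
        qed (simp add: k_def)
      qed
      also have "\<dots> = ennreal (1 / W y powr r) * (\<integral>\<^sup>+x\<in>cball y (2 * norm y). ennreal (norm (x - y) powr (-\<beta>) * v x) \<partial>lborel)"
        by (rule nn_integral_cmult) measurable
      also have "\<dots> \<le> ennreal (1 / W y powr r) * ennreal (K1 * A * (2 * norm y) powr (?n - \<beta>) * v y)"
        unfolding K1_def using vpos A \<beta> y elim by (intro mult_left_mono nn_integral_kernel_ball) (auto intro: less_imp_le)
      also have "\<dots> = ennreal (K1 * A * 2 powr (\<Theta> * r))"
      proof -
        have "1 / W y powr r * (K1 * A * (2 * norm y) powr (?n - \<beta>) * v y) = K1 * A * 2 powr (\<Theta> * r)"
          using y vpos[of y] unfolding Wr n\<beta> by (simp add: powr_mult)
        then show ?thesis by (simp add: ennreal_mult'[symmetric])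
      qed
      finally show ?case .
    qed
    have "(\<integral>\<^sup>+x. ennreal (\<bar>F x\<bar> powr r * v x) \<partial>lborel)
      \<le> (\<integral>\<^sup>+x. ennreal (K0 powr r * I powr (r - 1)) * (\<integral>\<^sup>+y. ennreal ((k x y / W y) powr r * m y) * ennreal (v x) \<partial>lborel) \<partial>lborel)"
    proof (rule nn_integral_mono)
      fix x
      have "ennreal (\<bar>F x\<bar> powr r * v x) \<le> ennreal (K0 powr r * I powr (r - 1)) * (\<integral>\<^sup>+y. ennreal ((k x y / W y) powr r * m y) \<partial>lborel) * ennreal (v x)"
        by (subst ennreal_mult'[OF powr_ge_zero]) (rule mult_right_mono[OF ptw], simp)
      then show "ennreal (\<bar>F x\<bar> powr r * v x) \<le> ennreal (K0 powr r * I powr (r - 1)) * (\<integral>\<^sup>+y. ennreal ((k x y / W y) powr r * m y) * ennreal (v x) \<partial>lborel)"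
        by (simp add: nn_integral_multc mult.assoc)
    qed
    also have "\<dots> = ennreal (K0 powr r * I powr (r - 1)) * (\<integral>\<^sup>+x. (\<integral>\<^sup>+y. ennreal ((k x y / W y) powr r * m y) * ennreal (v x) \<partial>lborel) \<partial>lborel)"
      by (rule nn_integral_cmult) (simp add: k_def)
    also have "(\<integral>\<^sup>+x. (\<integral>\<^sup>+y. ennreal ((k x y / W y) powr r * m y) * ennreal (v x) \<partial>lborel) \<partial>lborel)
       = (\<integral>\<^sup>+y. (\<integral>\<^sup>+x. ennreal ((k x y / W y) powr r * m y) * ennreal (v x) \<partial>lborel) \<partial>lborel)"
      unfolding k_def by (rule lborel_pair.Fubini') measurable
    also have "\<dots> = (\<integral>\<^sup>+y. ennreal (m y) * (\<integral>\<^sup>+x. ennreal ((k x y / W y) powr r * v x) \<partial>lborel) \<partial>lborel)"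
    proof (rule nn_integral_cong)
      fix y
      have "ennreal ((k x y / W y) powr r * m y) * ennreal (v x) = ennreal (m y) * ennreal ((k x y / W y) powr r * v x)" for x
        using m0[of y] vpos[of x] by (simp add: ennreal_mult[symmetric] mult_ac)
      then show "(\<integral>\<^sup>+x. ennreal ((k x y / W y) powr r * m y) * ennreal (v x) \<partial>lborel) = ennreal (m y) * (\<integral>\<^sup>+x. ennreal ((k x y / W y) powr r * v x) \<partial>lborel)"
        by (simp add: nn_integral_cmult)
    qed
    also have "\<dots> \<le> (\<integral>\<^sup>+y. ennreal (m y) * ennreal (K1 * A * 2 powr (\<Theta> * r)) \<partial>lborel)"
      by (rule nn_integral_mono_AE) (use ker in \<open>eventually_elim, auto intro: mult_left_mono\<close>)
    also have "\<dots> = (\<integral>\<^sup>+y. ennreal (m y) \<partial>lborel) * ennreal (K1 * A * 2 powr (\<Theta> * r))"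
      by (rule nn_integral_multc) measurable
    also have "\<dots> \<le> ennreal I * ennreal (K1 * A * 2 powr (\<Theta> * r))"
      by (rule mult_right_mono[OF mI]) simp
    also have "ennreal (K0 powr r * I powr (r - 1)) * \<dots> = ennreal (K * A * I powr r)"
    proof -
      have "I powr (r - 1) * I = I powr r" using I by (cases "I = 0") (auto simp: powr_mult_base mult.commute)
      then have "K * A * I powr r = K0 powr r * I powr (r - 1) * (I * (K1 * A * 2 powr (\<Theta> * r)))"
        unfolding K_def by (metis (no_types) mult.assoc mult.commute)
      moreover have "0 \<le> K1 * A * 2 powr (\<Theta> * r)" using K1 A by simp
      ultimately show ?thesis using I by (simp only: ennreal_mult powr_ge_zero mult_nonneg_nonneg)
    qed
    finally show "(\<integral>\<^sup>+x. ennreal (\<bar>F x\<bar> powr r * v x) \<partial>lborel) \<le> ennreal (K * A * I powr r)"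
      by (simp add: mult_left_mono)
  qed
qed

text \<open>\<open>sob\<close> is the gradient inequality for this one weight, with constant
  \<open>L\<close>. For \<open>X\<close> the integral of \<open>\<phi> powr q * v\<close>, Hoelder
  yields \<open>X \<le> L * I powr r\<close>, where \<open>I powr r\<close> contains
  \<open>X\<close> to the power \<open>1 - r/q\<close>. As \<open>X\<close> is finite, that factor
  can be divided out, and the bound no longer involves \<epsilon>.\<close>

lemma truncation_bound:
  fixes f v :: "real^'n \<Rightarrow> real" and p q r \<gamma> \<Theta> \<epsilon> L D :: real
  assumes p: "1 < p" and q: "0 < q" and \<gamma>: "\<gamma> = 1 + q * (1 - 1/p)" and r: "r = q / \<gamma>"
    and [measurable]: "v \<in> borel_measurable borel" and vpos: "\<And>x. 0 < v x"
    and fin: "\<And>\<rho>. (\<integral>\<^sup>+x\<in>cball 0 \<rho>. ennreal (v x) \<partial>lborel) < \<infinity>"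
    and f: "f \<in> C1_0" and \<epsilon>: "0 < \<epsilon>" and L: "0 \<le> L"
    and sob: "\<And>F dF R I. (\<And>x. GDERIV F x :> dF x) \<Longrightarrow> continuous_on UNIV dF \<Longrightarrow> (\<And>x. norm x > R \<Longrightarrow> F x = 0) \<Longrightarrow> 0 \<le> I \<Longrightarrow>
      (\<integral>\<^sup>+y. ennreal (norm (dF y) * (norm y powr \<Theta> * v y powr (1/r))) \<partial>lborel) \<le> ennreal I \<Longrightarrow>
      (\<integral>\<^sup>+x. ennreal (\<bar>F x\<bar> powr r * v x) \<partial>lborel) \<le> ennreal (L * I powr r)"
    and D: "0 \<le> D"
      "(\<integral>\<^sup>+x. ennreal (norm (gradient f x) powr p * norm x powr (\<Theta> * p) * v x powr (p/q)) \<partial>lborel) \<le> ennreal D"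
  shows "(\<integral>\<^sup>+x. ennreal (max 0 (\<bar>f x\<bar> - \<epsilon>) powr q * v x) \<partial>lborel) \<le> ennreal ((L * \<gamma> powr r) powr (q/r) * D powr (q/p))"
proof -
  have \<gamma>1: "\<gamma> > 1" using p q by (simp add: \<gamma>)
  have r0: "r > 0" using q \<gamma>1 by (simp add: r)
  have \<gamma>r: "\<gamma> * r = q" using \<gamma>1 by (simp add: r)
  have inv_r: "1 / r = 1 / q + 1 - 1 / p" using q p \<gamma>1 by (simp add: r \<gamma> field_simps)
  have diff: "f differentiable (at x)" and cgrad: "continuous_on UNIV (gradient f)" and lim: "(f \<longlongrightarrow> 0) at_infinity" for x
    using f by (auto simp: C1_0_def)
  have cf: "continuous_on UNIV f"
    using diff by (meson continuous_at_imp_continuous_on differentiable_imp_continuous_within)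
  have [measurable]: "f \<in> borel_measurable borel" "gradient f \<in> borel_measurable borel"
    using cf cgrad by (auto intro: borel_measurable_continuous_onI)
  define \<phi> where "\<phi> x = max 0 (\<bar>f x\<bar> - \<epsilon>)" for x
  have [measurable]: "\<phi> \<in> borel_measurable borel" unfolding \<phi>_def by measurable
  have \<phi>0: "0 \<le> \<phi> x" for x by (simp add: \<phi>_def)
  \<comment> \<open>Two one-sided powers avoid differentiating the absolute value of
    \<open>f\<close>. Because \<epsilon> is positive they are never nonzero together, so neither
    \<psi> nor its derivative mixes the two terms.\<close>
  define \<psi> where "\<psi> t = max 0 (t - \<epsilon>) powr \<gamma> + max 0 (- t - \<epsilon>) powr \<gamma>" for t
  define \<psi>' where "\<psi>' t = \<gamma> * max 0 (t - \<epsilon>) powr (\<gamma> - 1) - \<gamma> * max 0 (- t - \<epsilon>) powr (\<gamma> - 1)" for t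
  have \<psi>_deriv: "(\<psi> has_real_derivative \<psi>' t) (at t)" for t
  proof -
    have 1: "((\<lambda>t. max 0 (t - \<epsilon>) powr \<gamma>) has_real_derivative \<gamma> * max 0 (t - \<epsilon>) powr (\<gamma> - 1) * 1) (at t)"
      by (rule DERIV_chain2[OF has_real_derivative_max_powr[OF \<gamma>1]]) (auto intro!: derivative_eq_intros)
    have 2: "((\<lambda>t. max 0 (- t - \<epsilon>) powr \<gamma>) has_real_derivative \<gamma> * max 0 (- t - \<epsilon>) powr (\<gamma> - 1) * (-1)) (at t)"
      by (rule DERIV_chain2[OF has_real_derivative_max_powr[OF \<gamma>1]]) (auto intro!: derivative_eq_intros)
    show ?thesis using DERIV_add[OF 1 2] by (simp add: \<psi>_def[abs_def] \<psi>'_def)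
  qed
  have \<psi>_eq: "\<psi> (f x) = \<phi> x powr \<gamma>" for x
    using \<epsilon> \<gamma>1 by (cases "f x \<ge> 0") (auto simp: \<psi>_def \<phi>_def max_def)
  have \<psi>'_abs: "\<bar>\<psi>' (f x)\<bar> = \<gamma> * \<phi> x powr (\<gamma> - 1)" for x
    using \<epsilon> \<gamma>1 by (cases "f x \<ge> 0") (auto simp: \<psi>'_def \<phi>_def max_def abs_mult)
  define dG where "dG x = \<psi>' (f x) *\<^sub>R gradient f x" for x
  have "GDERIV (\<lambda>x. \<psi> (f x)) x :> dG x" for x
    unfolding dG_def by (rule GDERIV_DERIV_compose[OF GDERIV_gradient[OF diff] \<psi>_deriv])
  then have G: "GDERIV (\<lambda>x. \<phi> x powr \<gamma>) x :> dG x" for x by (simp add: \<psi>_eq)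
  have contG: "continuous_on UNIV dG"
    unfolding dG_def \<psi>'_def using \<gamma>1
    by (intro continuous_intros cf cgrad continuous_on_powr') auto
  \<comment> \<open>Vanishing at infinity enters here: the truncation of \<open>f\<close> at height
    \<epsilon> is zero outside a ball, as \<open>sob\<close> demands.\<close>
  obtain R where R: "\<And>x. norm x > R \<Longrightarrow> \<bar>f x\<bar> < \<epsilon>"
  proof -
    have "\<forall>\<^sub>F x in at_infinity. \<bar>f x\<bar> < \<epsilon>"
      using tendstoD[OF lim \<epsilon>] by simp
    then obtain b where "\<forall>x. b \<le> norm x \<longrightarrow> \<bar>f x\<bar> < \<epsilon>" by (auto simp: eventually_at_infinity)
    then show thesis by (intro that[of b]) auto
  qed
  then have \<phi>R: "\<phi> x = 0" if "norm x > R" for x using that by (fastforce simp: \<phi>_def)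
  have "bounded (f ` cball 0 R)"
    by (intro compact_imp_bounded compact_continuous_image continuous_on_subset[OF cf]) auto
  then obtain B where "\<forall>x\<in>cball 0 R. \<bar>f x\<bar> \<le> B" by (auto simp: bounded_iff)
  then have B: "\<bar>f x\<bar> \<le> B" if "norm x \<le> R" for x using that by simp
  let ?X = "\<integral>\<^sup>+x. ennreal (\<phi> x powr q * v x) \<partial>lborel"
  \<comment> \<open>The truncation is bounded with bounded support and \<open>v\<close> is locally
    integrable. This finiteness permits the later absorption.\<close>
  have "?X < \<infinity>"
  proof -
    have "?X \<le> (\<integral>\<^sup>+x. ennreal (\<bar>B\<bar> powr q) * (ennreal (v x) * indicator (cball 0 R) x) \<partial>lborel)"
    proof (rule nn_integral_mono)
      fix x
      show "ennreal (\<phi> x powr q * v x) \<le> ennreal (\<bar>B\<bar> powr q) * (ennreal (v x) * indicator (cball 0 R) x)"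
      proof (cases "norm x \<le> R")
        case True
        then have "\<phi> x \<le> \<bar>B\<bar>" using B[of x] \<epsilon> by (auto simp: \<phi>_def)
        then have "\<phi> x powr q * v x \<le> \<bar>B\<bar> powr q * v x"
          using \<phi>0 q vpos[of x] by (intro mult_right_mono powr_mono2) auto
        then show ?thesis using True vpos[of x] by (simp add: ennreal_mult[symmetric] ennreal_leI)
      qed (simp add: \<phi>R)
    qed
    also have "\<dots> = ennreal (\<bar>B\<bar> powr q) * (\<integral>\<^sup>+x\<in>cball 0 R. ennreal (v x) \<partial>lborel)"
    proof -
      have [measurable]: "cball (0::real^'n) R \<in> sets borel" by simp
      show ?thesis by (rule nn_integral_cmult) measurable
    qed
    also have "\<dots> < \<infinity>" using fin by (simp add: ennreal_mult_less_top)
    finally show ?thesis .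
  qed
  then obtain X where X: "0 \<le> X" "?X = ennreal X" by (cases ?X) auto
  define m where "m y = \<phi> y powr q * v y" for y
  \<comment> \<open>Chosen so that \<open>h m\<close> is the integrand of \<open>sob\<close> and that \<open>\<phi>\<close> cancels from \<open>h powr p * m\<close>; where \<open>\<phi>\<close> vanishes,
    so does its negative power.\<close>
  define h where "h y = \<gamma> * norm (gradient f y) * norm y powr \<Theta> * v y powr (1/r - 1) * \<phi> y powr (\<gamma> - 1 - q)" for y
  have [measurable]: "m \<in> borel_measurable borel" "h \<in> borel_measurable borel"
    unfolding m_def h_def by measurable
  have m0: "0 \<le> m y" for y using vpos[of y] by (simp add: m_def)
  have h0: "0 \<le> h y" for y using \<gamma>1 by (simp add: h_def)
  have hm: "norm (dG y) * (norm y powr \<Theta> * v y powr (1/r)) = h y * m y" for y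
  proof -
    have "v y powr (1/r) = v y powr (1/r - 1) * v y" using powr_add[of "v y" "1/r - 1" 1] vpos[of y] by simp
    moreover have "\<phi> y powr (\<gamma> - 1) = \<phi> y powr (\<gamma> - 1 - q) * \<phi> y powr q" by (simp add: powr_add[symmetric])
    ultimately show ?thesis by (simp add: dG_def \<psi>'_abs h_def m_def)
  qed
  have hpm: "h y powr p * m y \<le> \<gamma> powr p * (norm (gradient f y) powr p * norm y powr (\<Theta> * p) * v y powr (p/q))" for y
  proof (cases "\<phi> y = 0")
    case False
    have "(1/r - 1) * p + 1 = p / q" unfolding inv_r using p q by (simp add: field_simps)
    then have 1: "v y powr ((1/r - 1) * p) * v y = v y powr (p/q)"
      using powr_add[of "v y" "(1/r - 1) * p" 1] vpos[of y] by simp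
    have "(\<gamma> - 1 - q) * p + q = 0" unfolding \<gamma> using p by (simp add: field_simps)
    then have 2: "\<phi> y powr ((\<gamma> - 1 - q) * p) * \<phi> y powr q = 1"
      using False by (simp add: powr_add[symmetric])
    have "h y powr p = \<gamma> powr p * norm (gradient f y) powr p * norm y powr (\<Theta> * p) * v y powr ((1/r - 1) * p) * \<phi> y powr ((\<gamma> - 1 - q) * p)"
      using \<gamma>1 by (simp add: h_def powr_mult powr_powr)
    then have "h y powr p * m y = \<gamma> powr p * norm (gradient f y) powr p * norm y powr (\<Theta> * p) * (v y powr ((1/r - 1) * p) * v y) * (\<phi> y powr ((\<gamma> - 1 - q) * p) * \<phi> y powr q)"
      by (simp only: m_def mult_ac)
    then show ?thesis unfolding 1 2 by (simp add: mult_ac)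
  qed (simp add: m_def q)
  define I where "I = (X powr (p - 1) * (\<gamma> powr p * D)) powr (1/p)"
  \<comment> \<open>Hoelder's inequality with exponent \<open>p\<close> for the density
    \<open>m\<close>, whose total mass is \<open>X\<close>. It is stated for every real
    \<open>J\<close> below the integral because finiteness is not yet known; an infinite integral is
    refuted by \<open>J = I + 1\<close>.\<close>
  have bound: "J \<le> I" if J: "0 \<le> J" "ennreal J \<le> (\<integral>\<^sup>+y. ennreal (h y * m y) \<partial>lborel)" for J
  proof -
    have "ennreal (J powr p) \<le> ennreal (X powr (p - 1)) * (\<integral>\<^sup>+y. ennreal (h y powr p * m y) \<partial>lborel)"
      using J X p by (intro nn_integral_Jensen_powr) (auto simp: h0 m0 m_def[symmetric])
    also have "(\<integral>\<^sup>+y. ennreal (h y powr p * m y) \<partial>lborel) \<le>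
      (\<integral>\<^sup>+y. ennreal (\<gamma> powr p) * ennreal (norm (gradient f y) powr p * norm y powr (\<Theta> * p) * v y powr (p/q)) \<partial>lborel)"
      by (rule nn_integral_mono) (use hpm in \<open>auto simp: ennreal_mult'[symmetric] intro: ennreal_leI\<close>)
    also have "\<dots> = ennreal (\<gamma> powr p) * (\<integral>\<^sup>+y. ennreal (norm (gradient f y) powr p * norm y powr (\<Theta> * p) * v y powr (p/q)) \<partial>lborel)"
      by (rule nn_integral_cmult) measurable
    also have "\<dots> \<le> ennreal (\<gamma> powr p) * ennreal D" by (rule mult_left_mono[OF D(2)]) simp
    finally have "ennreal (J powr p) \<le> ennreal (X powr (p - 1) * (\<gamma> powr p * D))"
      using D(1) by (simp add: ennreal_mult mult_left_mono)
    then have "J powr p \<le> X powr (p - 1) * (\<gamma> powr p * D)" using D(1) by (subst (asm) ennreal_le_iff) auto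
    then have "(J powr p) powr (1/p) \<le> I" unfolding I_def using p by (intro powr_mono2) auto
    then show ?thesis using p J by (simp add: powr_powr)
  qed
  have I0: "0 \<le> I" by (simp add: I_def)
  have "(\<integral>\<^sup>+y. ennreal (h y * m y) \<partial>lborel) \<le> ennreal I"
  proof (cases "\<integral>\<^sup>+y. ennreal (h y * m y) \<partial>lborel")
    case (real J)
    then show ?thesis using bound[of J] by (simp add: ennreal_leI)
  next
    case top
    then have "I + 1 \<le> I" using I0 by (intro bound) auto
    then show ?thesis by simp
  qed
  then have "(\<integral>\<^sup>+x. ennreal (\<bar>\<phi> x powr \<gamma>\<bar> powr r * v x) \<partial>lborel) \<le> ennreal (L * I powr r)"
    by (intro sob[OF G contG _ I0]) (use \<phi>R \<gamma>1 in \<open>auto simp: hm\<close>)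
  then have "ennreal X \<le> ennreal (L * I powr r)"
    by (simp add: powr_powr \<gamma>r X(2)[symmetric])
  then have XI: "X \<le> L * I powr r" using L by (subst (asm) ennreal_le_iff) auto
  have "X \<le> (L * \<gamma> powr r) powr (q/r) * D powr (q/p)"
  proof (cases "X = 0")
    case False
    with X have Xpos: "X > 0" by simp
    \<comment> \<open>Absorption: \<open>X\<close> splits into \<open>X powr (r / q)\<close> times
      the power of \<open>X\<close> hidden in \<open>I powr r\<close>, and the latter cancels as
      \<open>X\<close> is positive.\<close>
    have e: "(p - 1) * (r / p) + r / q = 1"
    proof -
      have "(p - 1) * (r / p) + r / q = r * (1/r)" unfolding inv_r using p q by (simp add: field_simps)
      then show ?thesis using r0 by simp
    qed
    have "I powr r = X powr ((p - 1) * (r / p)) * (\<gamma> powr r * D powr (r / p))"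
      using p D(1) \<gamma>1 by (simp add: I_def powr_mult powr_powr)
    with XI have "X powr (r / q) * X powr ((p - 1) * (r / p)) \<le> L * \<gamma> powr r * D powr (r / p) * X powr ((p - 1) * (r / p))"
      using e Xpos by (simp add: powr_add[symmetric] add.commute mult_ac)
    then have "X powr (r / q) \<le> L * \<gamma> powr r * D powr (r / p)"
      using Xpos by simp
    then have "(X powr (r / q)) powr (q / r) \<le> (L * \<gamma> powr r * D powr (r / p)) powr (q / r)"
      using q r0 by (intro powr_mono2) auto
    then show ?thesis using Xpos q r0 L D(1) by (simp add: powr_powr powr_mult)
  qed simp
  then show ?thesis using X by (simp add: \<phi>_def[symmetric] ennreal_leI)
qed

section \<open>The full inequality: choice of exponents, Borel weight, limit of truncations\<close>

theorem corollary6p6: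
  fixes p q p' \<Theta> :: real
  assumes "CARD('n::finite) > 1"
    and "1 < p" and "p \<le> q"
    and "1/p + 1/p' = 1"
    and "\<Theta> = 1 + real CARD('n) * (1/q - 1/p)"
    and "\<Theta> > 0"
    and "p' * \<Theta> < real CARD('n)"
  shows "\<exists>C :: ennreal \<Rightarrow> real. (\<forall>t. C t > 0) \<and>
    (\<forall>u :: real^'n \<Rightarrow> real. u \<in> A1_weights \<longrightarrow> (\<forall>f \<in> C1_0.
       ennreal_powr (\<integral>\<^sup>+x. ennreal (\<bar>f x\<bar> powr q * u x) \<partial>lebesgue) (1/q)
       \<le> ennreal (C (A1_const u)) *
         ennreal_powr (\<integral>\<^sup>+x. ennreal (norm (gradient f x) powr p * norm x powr (\<Theta> * p)
                                  * u x powr (p/q)) \<partial>lebesgue) (1/p)))"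
proof -
  let ?n = "real CARD('n)"
  note p = \<open>1 < p\<close> and pq = \<open>p \<le> q\<close>
  have q: "0 < q" "1 < q" using p pq by auto
  define \<gamma> where "\<gamma> = 1 + q * (1 - 1/p)"
  define r where "r = q / \<gamma>"
  have \<gamma>1: "\<gamma> > 1" using p q by (simp add: \<gamma>_def)
  have r: "1 \<le> r"
  proof -
    have "q * 1 \<le> q * (q / p)" using p pq q by (intro mult_left_mono) auto
    then have "\<gamma> \<le> q" using p pq by (simp add: \<gamma>_def field_simps)
    then show ?thesis using \<gamma>1 by (simp add: r_def)
  qed
  have nr: "?n = (?n - 1 + \<Theta>) * r"
  proof -
    have "?n - 1 + \<Theta> = ?n * (\<gamma> / q)"
      using p q by (simp add: assms(5) \<gamma>_def field_simps)
    then show ?thesis using q \<gamma>1 by (simp add: r_def)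
  qed
  obtain K where K: "K > 0" and sob: "\<And>(v :: real^'n \<Rightarrow> real) A F dF R I.
    v \<in> borel_measurable borel \<Longrightarrow> (\<And>x. 0 < v x) \<Longrightarrow> 0 \<le> A \<Longrightarrow>
    (AE y in lborel. \<forall>\<rho>>0. (\<integral>\<^sup>+x\<in>cball y \<rho>. ennreal (v x) \<partial>lborel) \<le> ennreal (A * (4 * \<rho>) ^ CARD('n) * v y)) \<Longrightarrow>
    (\<And>x. GDERIV F x :> dF x) \<Longrightarrow> continuous_on UNIV dF \<Longrightarrow> (\<And>x. norm x > R \<Longrightarrow> F x = 0) \<Longrightarrow> 0 \<le> I \<Longrightarrow>
    (\<integral>\<^sup>+y. ennreal (norm (dF y) * (norm y powr \<Theta> * v y powr (1/r))) \<partial>lborel) \<le> ennreal I \<Longrightarrow>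
    (\<integral>\<^sup>+x. ennreal (\<bar>F x\<bar> powr r * v x) \<partial>lborel) \<le> ennreal (K * A * I powr r)"
    by (rule weighted_L1_sobolev[OF r \<open>\<Theta> > 0\<close> nr]) blast
  \<comment> \<open>\<open>K\<close> depends only on the dimension and the exponents, so
    \<open>C\<close> is a function of the weight constant alone. Adding \<open>1\<close> keeps it
    positive where \<open>enn2real t\<close> is zero.\<close>
  define C where "C t = (K * enn2real t * \<gamma> powr r) powr (1/r) + 1" for t
  show ?thesis
  proof (intro exI[of _ C] conjI allI impI ballI)
    show "C t > 0" for t by (simp add: C_def add_nonneg_pos)
    fix u f :: "real^'n \<Rightarrow> real"
    assume u: "u \<in> A1_weights" and f: "f \<in> C1_0"
    define A where "A = enn2real (A1_const u)"
    obtain v where v[measurable]: "v \<in> borel_measurable borel" and vpos: "\<And>x. 0 < v x" and ae: "AE x in lborel. u x = v x"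
      and ball: "AE y in lborel. \<forall>\<rho>>0. (\<integral>\<^sup>+x\<in>cball y \<rho>. ennreal (v x) \<partial>lborel) \<le> ennreal (A * (4 * \<rho>) ^ CARD('n) * v y)"
      unfolding A_def using A1_borel_version[OF u] by blast
    have A: "0 \<le> A" by (simp add: A_def)
    let ?D = "\<integral>\<^sup>+x. ennreal (norm (gradient f x) powr p * norm x powr (\<Theta> * p) * v x powr (p/q)) \<partial>lborel"
    let ?X = "\<integral>\<^sup>+x. ennreal (\<bar>f x\<bar> powr q * v x) \<partial>lborel"
    have eqX: "(\<integral>\<^sup>+x. ennreal (\<bar>f x\<bar> powr q * u x) \<partial>lebesgue) = ?X"
      unfolding nn_integral_completion by (rule nn_integral_cong_AE) (use ae in \<open>eventually_elim, simp\<close>)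
    have eqD: "(\<integral>\<^sup>+x. ennreal (norm (gradient f x) powr p * norm x powr (\<Theta> * p) * u x powr (p/q)) \<partial>lebesgue) = ?D"
      unfolding nn_integral_completion by (rule nn_integral_cong_AE) (use ae in \<open>eventually_elim, simp\<close>)
    have "ennreal_powr ?X (1/q) \<le> ennreal (C (A1_const u)) * ennreal_powr ?D (1/p)"
    proof (cases ?D)
      case top
      \<comment> \<open>Positivity is essential for an infinite right-hand side, since zero times
        infinity is zero in \<open>ennreal\<close>.\<close>
      have "C (A1_const u) > 0" by (simp add: C_def add_nonneg_pos)
      with top show ?thesis by (simp add: ennreal_powr_def ennreal_mult_top)
    next
      case (real D)
      define M where "M = (K * A * \<gamma> powr r) powr (q/r) * D powr (q/p)"
      \<comment> \<open>One point \<open>y\<close> where the ball bound holds suffices: every ball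
        around the origin lies in a ball around \<open>y\<close>. Such a \<open>y\<close> exists
        because Lebesgue measure is not zero.\<close>
      have fin: "(\<integral>\<^sup>+x\<in>cball 0 \<rho>. ennreal (v x) \<partial>lborel) < \<infinity>" for \<rho>
      proof -
        obtain y where y: "\<forall>\<rho>>0. (\<integral>\<^sup>+x\<in>cball y \<rho>. ennreal (v x) \<partial>lborel) \<le> ennreal (A * (4 * \<rho>) ^ CARD('n) * v y)"
        proof -
          have "ae_filter (lborel :: (real^'n) measure) \<noteq> bot"
            by (auto simp: trivial_limit_def eventually_ae_filter top.extremum_unique null_sets_def)
          from eventually_happens'[OF this ball] that show thesis by blast
        qed
        have "(\<integral>\<^sup>+x\<in>cball 0 \<rho>. ennreal (v x) \<partial>lborel) \<le> (\<integral>\<^sup>+x\<in>cball y (\<bar>\<rho>\<bar> + norm y + 1). ennreal (v x) \<partial>lborel)"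
        proof (intro nn_integral_mono mult_left_mono)
          fix x
          have "dist y x \<le> norm y + norm x" by (metis dist_norm norm_triangle_ineq4)
          then show "indicator (cball 0 \<rho>) x \<le> (indicator (cball y (\<bar>\<rho>\<bar> + norm y + 1)) x :: ennreal)"
            by (auto simp: indicator_def)
        qed simp
        also have "\<dots> \<le> ennreal (A * (4 * (\<bar>\<rho>\<bar> + norm y + 1)) ^ CARD('n) * v y)"
          by (intro y[rule_format]) (simp add: add_nonneg_pos)
        also have "\<dots> < \<infinity>" by simp
        finally show ?thesis .
      qed
      have trunc: "(\<integral>\<^sup>+x. ennreal (max 0 (\<bar>f x\<bar> - \<epsilon>) powr q * v x) \<partial>lborel) \<le> ennreal M" if "\<epsilon> > 0" for \<epsilon>
        unfolding M_def
      proof (rule truncation_bound[OF p q(1) \<gamma>_def r_def v vpos fin f that])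
        show "0 \<le> K * A" using K A by simp
        show "(\<integral>\<^sup>+x. ennreal (\<bar>F x\<bar> powr r * v x) \<partial>lborel) \<le> ennreal (K * A * I powr r)"
          if "\<And>x. GDERIV F x :> dF x" "continuous_on UNIV dF" "\<And>x. norm x > R \<Longrightarrow> F x = 0" "0 \<le> I"
            "(\<integral>\<^sup>+y. ennreal (norm (dF y) * (norm y powr \<Theta> * v y powr (1/r))) \<partial>lborel) \<le> ennreal I" for F dF R I
          by (rule sob[OF v vpos A ball that])
        show "0 \<le> D" "?D \<le> ennreal D" using real by simp_all
      qed
      have cf: "continuous_on UNIV f"
        using f unfolding C1_0_def by (auto intro!: continuous_at_imp_continuous_on differentiable_imp_continuous_within)
      then have [measurable]: "f \<in> borel_measurable borel" by (rule borel_measurable_continuous_onI)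
      \<comment> \<open>Truncation heights \<open>1 / (k + 1)\<close> tend to zero and
        \<open>M\<close> does not depend on them, so Fatou's lemma carries the bound over to
        \<open>f\<close>.\<close>
      let ?g = "\<lambda>k x. ennreal (max 0 (\<bar>f x\<bar> - 1 / real (Suc k)) powr q * v x)"
      have "?X = (\<integral>\<^sup>+x. liminf (\<lambda>k. ?g k x) \<partial>lborel)"
      proof (rule nn_integral_cong)
        fix x
        have "(\<lambda>k. max 0 (\<bar>f x\<bar> - 1 / real (Suc k)) powr q * v x) \<longlonglongrightarrow> max 0 (\<bar>f x\<bar> - 0) powr q * v x"
          using q(1) by (intro tendsto_intros LIMSEQ_Suc[OF lim_1_over_n] tendsto_powr' ) auto
        then have "(\<lambda>k. ?g k x) \<longlonglongrightarrow> ennreal (\<bar>f x\<bar> powr q * v x)"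
          by (auto intro: tendsto_ennrealI)
        then show "ennreal (\<bar>f x\<bar> powr q * v x) = liminf (\<lambda>k. ?g k x)"
          by (simp add: lim_imp_Liminf)
      qed
      also have "\<dots> \<le> liminf (\<lambda>k. \<integral>\<^sup>+x. ?g k x \<partial>lborel)"
        by (rule nn_integral_liminf) measurable
      also have "\<dots> \<le> ennreal M"
        by (rule order.trans[OF Liminf_le_Limsup Limsup_bounded]) (auto intro!: always_eventually trunc)
      finally have XM: "?X \<le> ennreal M" .
      then obtain X where X: "0 \<le> X" "?X = ennreal X" by (cases ?X) (auto simp: top_unique)
      with XM have "X \<le> M" by (simp add: M_def)
      then have "X powr (1/q) \<le> M powr (1/q)" using X q by (intro powr_mono2) auto
      also have "\<dots> = (K * A * \<gamma> powr r) powr (1/r) * D powr (1/p)"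
        using q p r real K A by (simp add: M_def powr_mult powr_powr)
      also have "\<dots> \<le> C (A1_const u) * D powr (1/p)"
        by (intro mult_right_mono) (auto simp: C_def A_def)
      finally have "X powr (1/q) \<le> C (A1_const u) * D powr (1/p)" .
      moreover have "0 \<le> C (A1_const u)" by (simp add: C_def)
      ultimately show ?thesis
        using X real by (simp add: ennreal_powr_def ennreal_mult[symmetric] ennreal_leI)
    qed
    then show "ennreal_powr (\<integral>\<^sup>+x. ennreal (\<bar>f x\<bar> powr q * u x) \<partial>lebesgue) (1/q)
       \<le> ennreal (C (A1_const u)) *
         ennreal_powr (\<integral>\<^sup>+x. ennreal (norm (gradient f x) powr p * norm x powr (\<Theta> * p)
                                  * u x powr (p/q)) \<partial>lebesgue) (1/p)"
      unfolding eqX eqD .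
  qed
qed

end
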